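(* Let a skew Kokotsakis mesh be given, with planar angles $(\alpha_i,\beta_i,\gamma_i,\delta_i)$, $i=1,\dots,4$, and dihedral parameters $F_1,\dots,F_4\in\mathbb R$, and let $\lambda_i,\mu_i,\nu_i,t_i$ be the associated parameters defined in the context. Assume that the mesh belongs to the elliptic orthodiagonal involutive type and that it satisfies the local existence conditions, i.e. for every $i\in\{1,2,3,4\}$ either at least one of $\lambda_i,\mu_i$ is negative, or $\lambda_i>0$, $\mu_i>0$ and $\frac{\nu_i^2}{\lambda_i\mu_i}>16$. Then the mesh is flexible if and only if one of the following holds: (1) $\lambda_i<0$ and $\mu_i>0$ for all $i$, and $$t_2=0\quad\text{or}\quad 16\sqrt{\mu_1\mu_2}-|\nu_1\nu_2|<\frac{4|\nu_2|\sqrt{\mu_1}+4|\nu_1|\sqrt{\mu_2}}{|t_2|};$$ (2) $\lambda_i>0$ and $\mu_i<0$ for all $i$, and $$t_3=0\quad\text{or}\quad 16\sqrt{\lambda_2\lambda_3}-|\nu_2\nu_3|<\frac{4|\nu_3|\sqrt{\lambda_2}+4|\nu_2|\sqrt{\lambda_3}}{|t_3|};$$ (3) the combination of signs of the $\lambda_i,\mu_i$ is any other one, i.e. it is neither the case that $\lambda_i<0,\ \mu_i>0$ for all $i$, nor the case that $\lambda_i>0,\ \mu_i<0$ for all $i$. (If $t_2=\infty$, resp. $t_3=\infty$, the right-hand side of the inequality is read as $0$.)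
   Context: Indices are cyclic modulo $4$. **Mesh.** A skew Kokotsakis mesh is a $3\times3$ quad mesh (faces need not be planar) with central quad $A_1A_2A_3A_4$. Each $A_i$ is joined to two further vertices $B_i,C_i$; the side quads are $C_{i-1}A_{i-1}A_iB_i$ and the corner faces can be taken to be the triangles $B_iA_iC_i$. All faces are rigid (skew quads are regarded as rigid tetrahedra), and common edges are revolute joints. The planar angles, all in $(0,\pi)$ and constant, are: $\delta_i=\angle A_{i-1}A_iA_{i+1}$, $\beta_i=\angle B_iA_iC_i$; for $i=1,3$: $\alpha_i=\angle C_iA_iA_{i+1}$, $\gamma_i=\angle B_iA_iA_{i-1}$; for $i=2,4$: $\alpha_i=\angle B_iA_iA_{i-1}$, $\gamma_i=\angle C_iA_iA_{i+1}$. Let $a_i=\overrightarrow{A_{i-1}A_i}$, $b_i=\overrightarrow{B_iA_i}$, $c_i=\overrightarrow{A_iC_i}$, $[\cdot,\cdot]$ the cross product, $(\cdot,\cdot)$ the scalar product, and a bar over a vector its normalization. The constant oriented dihedral angles of the central and side tetrahedra are $\tau_i=\operatorname{sign}(o_{\tau_i})\arccos(\overline{[a_{i-1},a_i]},\overline{[a_i,a_{i+1}]})$ with $o_{\tau_i}=([a_i,a_{i+1}],a_{i+2})$ for $i=1,3$ and $([a_{i-1},a_i],a_{i+1})$ for $i=2,4$; $\zeta_i=\operatorname{sign}(o_{\zeta_i})\arccos(\overline{[a_i,b_i]},\overline{[c_{i-1},a_i]})$ with $o_{\zeta_i}=([a_i,b_i],c_{i-1})$ for $i=1,3$ and $([c_{i-1},a_i],b_i)$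 for $i=2,4$. Only the following combination enters: $F_i=\tan\frac{\tau_i+\zeta_i}{2}$. It is assumed that $F_i\neq\pm\infty$. Put $t_i=\frac{2F_i}{1-F_i^2}\in\mathbb R\cup\{\infty\}$ (so $t_i=\infty$ iff $F_i^2=1$). **Orthodiagonal elliptic quadrilaterals.** $Q_i$ is the spherical quadrilateral with side lengths $\alpha_i,\beta_i,\gamma_i,\delta_i$ in this cyclic order. It is orthodiagonal if $\cos\alpha_i\cos\gamma_i=\cos\beta_i\cos\delta_i$ and elliptic if $\alpha_i\pm\beta_i\pm\gamma_i\pm\delta_i\not\equiv0\pmod{2\pi}$ for all choices of signs. For such a quadrilateral (index $i$ omitted): $\lambda=\frac{\tan\delta+\tan\alpha}{\tan\delta-\tan\alpha}$ unless $\alpha=\delta=\frac\pi2$, when $\lambda=\frac{\cos\beta+\cos\gamma}{\cos\beta-\cos\gamma}$; $\mu=\frac{\tan\delta+\tan\gamma}{\tan\delta-\tan\gamma}$ unless $\gamma=\delta=\frac\pi2$, when $\mu=\frac{\cos\beta+\cos\alpha}{\cos\beta-\cos\alpha}$; $\nu=\frac{(\lambda-1)(\mu-1)}{\cos\delta}$ if $\delta\ne\frac\pi2$; $\nu=2(\mu-1)\tan\alpha$ if $\delta=\gamma=\frac\pi2$; $\nu=2(\lambda-1)\tan\gamma$ if $\delta=\alpha=\frac\pi2$. Infinite tangents are treated as limits: e.g. $\lambda=-1$ if $\alpha=\frac\pi2\neq\delta$, $\lambda=1$ if $\delta=\frac\pi2\ne\alpha$, and $\nu=\frac4{\cos\beta}$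 if $\alpha=\gamma=\delta=\frac\pi2$. These are well-defined nonzero real numbers. **Flexibility.** Let $x_i=\tan\frac{\varphi_i}2$, $y_i=\tan\frac{\psi_i}2\in\mathbb{RP}^1$ be the half-tangents of the dihedral angles $\varphi_i,\psi_i$ along the edge $A_{i-1}A_i$ that vary during a motion; they satisfy $\psi_i=\varphi_i+\tau_i+\zeta_i$, i.e. $y_i=\frac{x_i+F_i}{1-F_ix_i}$. For orthodiagonal elliptic $Q_1,\dots,Q_4$, the configurations of the mesh are the solutions of $$(x_2+\lambda_1x_2^{-1})(x_1+\mu_1x_1^{-1})=\nu_1,\quad (y_2+\lambda_2y_2^{-1})(y_3+\mu_2y_3^{-1})=\nu_2,$$ $$(x_4+\lambda_3x_4^{-1})(x_3+\mu_3x_3^{-1})=\nu_3,\quad (y_4+\lambda_4y_4^{-1})(y_1+\mu_4y_1^{-1})=\nu_4$$ (with denominators cleared). The mesh is *flexible* if this system has a one-parameter family (not merely a discrete set) of real solutions $(x_1,x_2,x_3,x_4)\in(\mathbb{RP}^1)^4$. **Elliptic orthodiagonal involutive (OI) type.** The mesh is of this type if: (a) every $Q_i$ is orthodiagonal and elliptic; (b) for $i=2,4$: $\lambda_{i-1}=\lambda_i$ if $F_i=0$, and $\lambda_{i-1}=\lambda_i=-1$ if $F_i\in\mathbb R\setminus\{0\}$; for $j=1,3$: $\mu_{j-1}=\mu_j$ if $F_j=0$, and $\mu_{j-1}=\mu_j=-1$ if $F_j\in\mathbb R\setminus\{0\}$ (with $\mu_0=\mu_4$); (c) all $2\times2$ minors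 of the matrix $$\begin{pmatrix}2(4t_2+\nu_2t_3)&4(4t_2t_3-\nu_2)&\nu_1(4-\nu_2t_2t_3)&2\nu_1(\nu_2t_2+4t_3)\\ 2(\nu_4t_1+4t_4)&\nu_3(4-\nu_4t_1t_4)&4(4t_1t_4-\nu_4)&2\nu_3(4t_1+\nu_4t_4)\end{pmatrix}$$ vanish. If some $t_i=\infty$ this is understood projectively: multiply the first row by $(1-F_2^2)(1-F_3^2)$ and the second by $(1-F_1^2)(1-F_4^2)$ after substituting $t_i=2F_i/(1-F_i^2)$. *)

theory Defs
  imports "HOL-Analysis.Analysis"
begin

text \<open>
  Indices live in the numeral type \<open>4\<close>, whose arithmetic is cyclic modulo \<open>4\<close> (so \<open>4 = 0\<close>).
\<close>

record mesh =
  pA :: "4 \<Rightarrow> real^3"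
  pB :: "4 \<Rightarrow> real^3"
  pC :: "4 \<Rightarrow> real^3"

definition angle3 :: "real^3 \<Rightarrow> real^3 \<Rightarrow> real^3 \<Rightarrow> real" where
  "angle3 P Q R = arccos (((P - Q) \<bullet> (R - Q)) / (norm (P - Q) * norm (R - Q)))"

definition m_alpha :: "mesh \<Rightarrow> 4 \<Rightarrow> real" where
  "m_alpha M i = (if i \<in> {1,3} then angle3 (pC M i) (pA M i) (pA M (i+1))
                  else angle3 (pB M i) (pA M i) (pA M (i-1)))"

definition m_beta :: "mesh \<Rightarrow> 4 \<Rightarrow> real" where
  "m_beta M i = angle3 (pB M i) (pA M i) (pC M i)"

definition m_gamma :: "mesh \<Rightarrow> 4 \<Rightarrow> real" where
  "m_gamma M i = (if i \<in> {1,3} then angle3 (pB M i) (pA M i) (pA M (i-1))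
                  else angle3 (pC M i) (pA M i) (pA M (i+1)))"

definition m_delta :: "mesh \<Rightarrow> 4 \<Rightarrow> real" where
  "m_delta M i = angle3 (pA M (i-1)) (pA M i) (pA M (i+1))"

definition va :: "mesh \<Rightarrow> 4 \<Rightarrow> real^3" where "va M i = pA M i - pA M (i-1)"
definition vb :: "mesh \<Rightarrow> 4 \<Rightarrow> real^3" where "vb M i = pA M i - pB M i"
definition vc :: "mesh \<Rightarrow> 4 \<Rightarrow> real^3" where "vc M i = pC M i - pA M i"

text \<open>
  For planar quads the orientation \<open>o\<close> vanishes and the unoriented dihedral angle is \<open>0\<close> or
  \<open>\<pi>\<close>. With \<open>sgn 0 = 0\<close> an angle \<open>\<pi>\<close> would be turned into \<open>0\<close>, so the sign of \<open>0\<close> is taken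
  to be \<open>1\<close> here. Taking \<open>-1\<close> instead would change the dihedral angle by \<open>0\<close> or \<open>2\<pi>\<close> only.
\<close>

definition orient_sign :: "real \<Rightarrow> real" where
  "orient_sign r = (if r < 0 then -1 else 1)"

definition m_tau :: "mesh \<Rightarrow> 4 \<Rightarrow> real" where
  "m_tau M i =
     orient_sign (if i \<in> {1,3} then cross3 (va M i) (va M (i+1)) \<bullet> va M (i+2)
                  else cross3 (va M (i-1)) (va M i) \<bullet> va M (i+1))
     * arccos (sgn (cross3 (va M (i-1)) (va M i)) \<bullet> sgn (cross3 (va M i) (va M (i+1))))"

definition m_zeta :: "mesh \<Rightarrow> 4 \<Rightarrow> real" where
  "m_zeta M i =
     orient_sign (if i \<in> {1,3} then cross3 (va M i) (vb M i) \<bullet> vc M (i-1)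
                  else cross3 (vc M (i-1)) (va M i) \<bullet> vb M i)
     * arccos (sgn (cross3 (va M i) (vb M i)) \<bullet> sgn (cross3 (vc M (i-1)) (va M i)))"

definition m_F :: "mesh \<Rightarrow> 4 \<Rightarrow> real" where
  "m_F M i = tan ((m_tau M i + m_zeta M i) / 2)"

text \<open>
  Nondegeneracy of the edges has to be required separately, since \<open>angle3\<close> returns \<open>\<pi>/2\<close> when
  one of its legs has length zero. The last condition says that \<open>F\<^sub>i\<close> is finite.
\<close>

definition skew_Kokotsakis_mesh :: "mesh \<Rightarrow> bool" where
  "skew_Kokotsakis_mesh M \<longleftrightarrow>
     (\<forall>i. pA M (i-1) \<noteq> pA M i \<and> pB M i \<noteq> pA M i \<and> pC M i \<noteq> pA M i \<and>
          m_alpha M i \<in> {0<..<pi} \<and> m_beta M i \<in> {0<..<pi} \<and>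
          m_gamma M i \<in> {0<..<pi} \<and> m_delta M i \<in> {0<..<pi} \<and>
          cos ((m_tau M i + m_zeta M i) / 2) \<noteq> 0)"

definition orthodiagonal :: "real \<Rightarrow> real \<Rightarrow> real \<Rightarrow> real \<Rightarrow> bool" where
  "orthodiagonal \<alpha> \<beta> \<gamma> \<delta> \<longleftrightarrow> cos \<alpha> * cos \<gamma> = cos \<beta> * cos \<delta>"

definition elliptic :: "real \<Rightarrow> real \<Rightarrow> real \<Rightarrow> real \<Rightarrow> bool" where
  "elliptic \<alpha> \<beta> \<gamma> \<delta> \<longleftrightarrow>
     (\<forall>s1\<in>{-1,1}. \<forall>s2\<in>{-1,1}. \<forall>s3\<in>{-1,1}. \<forall>k::int.
        \<alpha> + s1 * \<beta> + s2 * \<gamma> + s3 * \<delta> \<noteq> 2 * pi * of_int k)"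

text \<open>Infinite tangents are replaced by the corresponding limits, as \<open>tan (pi/2) = 0\<close> in HOL.\<close>

definition od_lambda :: "real \<Rightarrow> real \<Rightarrow> real \<Rightarrow> real \<Rightarrow> real" where
  "od_lambda \<alpha> \<beta> \<gamma> \<delta> =
     (if \<alpha> = pi/2 \<and> \<delta> = pi/2 then (cos \<beta> + cos \<gamma>) / (cos \<beta> - cos \<gamma>)
      else if \<alpha> = pi/2 then -1
      else if \<delta> = pi/2 then 1
      else (tan \<delta> + tan \<alpha>) / (tan \<delta> - tan \<alpha>))"

definition od_mu :: "real \<Rightarrow> real \<Rightarrow> real \<Rightarrow> real \<Rightarrow> real" where
  "od_mu \<alpha> \<beta> \<gamma> \<delta> =
     (if \<gamma> = pi/2 \<and> \<delta> = pi/2 then (cos \<beta> + cos \<alpha>) / (cos \<beta> - cos \<alpha>)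
      else if \<gamma> = pi/2 then -1
      else if \<delta> = pi/2 then 1
      else (tan \<delta> + tan \<gamma>) / (tan \<delta> - tan \<gamma>))"

text \<open>
  If \<open>\<delta> = \<pi>/2\<close>, orthodiagonality forces \<open>\<alpha> = \<pi>/2\<close> or \<open>\<gamma> = \<pi>/2\<close>, so the last branch is the
  case \<open>\<delta> = \<alpha> = \<pi>/2\<close>.
\<close>

definition od_nu :: "real \<Rightarrow> real \<Rightarrow> real \<Rightarrow> real \<Rightarrow> real" where
  "od_nu \<alpha> \<beta> \<gamma> \<delta> =
     (if \<delta> \<noteq> pi/2 then (od_lambda \<alpha> \<beta> \<gamma> \<delta> - 1) * (od_mu \<alpha> \<beta> \<gamma> \<delta> - 1) / cos \<delta>
      else if \<alpha> = pi/2 \<and> \<gamma> = pi/2 then 4 / cos \<beta>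
      else if \<gamma> = pi/2 then 2 * (od_mu \<alpha> \<beta> \<gamma> \<delta> - 1) * tan \<alpha>
      else 2 * (od_lambda \<alpha> \<beta> \<gamma> \<delta> - 1) * tan \<gamma>)"

definition m_lambda :: "mesh \<Rightarrow> 4 \<Rightarrow> real" where
  "m_lambda M i = od_lambda (m_alpha M i) (m_beta M i) (m_gamma M i) (m_delta M i)"

definition m_mu :: "mesh \<Rightarrow> 4 \<Rightarrow> real" where
  "m_mu M i = od_mu (m_alpha M i) (m_beta M i) (m_gamma M i) (m_delta M i)"

definition m_nu :: "mesh \<Rightarrow> 4 \<Rightarrow> real" where
  "m_nu M i = od_nu (m_alpha M i) (m_beta M i) (m_gamma M i) (m_delta M i)"

text \<open>\<open>None\<close> is the point at infinity; the topology is that of the one-point compactification.\<close>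

type_synonym rp1 = "real option"

definition rp1_top :: "rp1 topology" where
  "rp1_top = Alexandroff_compactification euclideanreal"

definition hom_coords :: "rp1 \<Rightarrow> real \<times> real" where
  "hom_coords x = (case x of None \<Rightarrow> (1, 0) | Some r \<Rightarrow> (r, 1))"

definition m_t :: "mesh \<Rightarrow> 4 \<Rightarrow> rp1" where
  "m_t M i = (if (m_F M i)\<^sup>2 = 1 then None else Some (2 * m_F M i / (1 - (m_F M i)\<^sup>2)))"

text \<open>The projective extension of \<open>x \<mapsto> (x + F) / (1 - F x)\<close>.\<close>

definition moebius_shift :: "real \<Rightarrow> rp1 \<Rightarrow> rp1" where
  "moebius_shift F x =
     (case x of
        None \<Rightarrow> (if F = 0 then None else Some (- 1 / F))
      | Some r \<Rightarrow> (if 1 - F * r = 0 then None else Some ((r + F) / (1 - F * r))))"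

text \<open>
  \<open>(u + l u\<^sup>-\<^sup>1) (w + m w\<^sup>-\<^sup>1) = n\<close> with denominators cleared,
  i.e. \<open>(u\<^sup>2 + l) (w\<^sup>2 + m) = n u w\<close>, made bihomogeneous.
\<close>

definition quad_eq :: "real \<Rightarrow> real \<Rightarrow> real \<Rightarrow> rp1 \<Rightarrow> rp1 \<Rightarrow> bool" where
  "quad_eq l m n u w \<longleftrightarrow>
     (case hom_coords u of (p, q) \<Rightarrow> case hom_coords w of (r, s) \<Rightarrow>
        (p\<^sup>2 + l * q\<^sup>2) * (r\<^sup>2 + m * s\<^sup>2) = n * p * q * r * s)"

definition configuration :: "mesh \<Rightarrow> (4 \<Rightarrow> rp1) \<Rightarrow> bool" where
  "configuration M x \<longleftrightarrow>
     (let y = (\<lambda>i. moebius_shift (m_F M i) (x i)) in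
        quad_eq (m_lambda M 1) (m_mu M 1) (m_nu M 1) (x 2) (x 1) \<and>
        quad_eq (m_lambda M 2) (m_mu M 2) (m_nu M 2) (y 2) (y 3) \<and>
        quad_eq (m_lambda M 3) (m_mu M 3) (m_nu M 3) (x 4) (x 3) \<and>
        quad_eq (m_lambda M 4) (m_mu M 4) (m_nu M 4) (y 4) (y 1))"

text \<open>
  A one-parameter family of solutions is an injectively parametrised continuous curve
  in \<open>(\<real>P\<^sup>1)\<^sup>4\<close>.
\<close>

definition flexible :: "mesh \<Rightarrow> bool" where
  "flexible M \<longleftrightarrow>
     (\<exists>g. pathin (product_topology (\<lambda>_. rp1_top) UNIV) g \<and> inj_on g {0..1} \<and>
          (\<forall>s\<in>{0..1}. configuration M (g s)))"

definition oi_row1 :: "real \<Rightarrow> real \<Rightarrow> real \<Rightarrow> real \<Rightarrow> real^4" where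
  "oi_row1 n1 n2 t2 t3 =
     vector [2 * (4 * t2 + n2 * t3), 4 * (4 * t2 * t3 - n2),
             n1 * (4 - n2 * t2 * t3), 2 * n1 * (n2 * t2 + 4 * t3)]"

definition oi_row2 :: "real \<Rightarrow> real \<Rightarrow> real \<Rightarrow> real \<Rightarrow> real^4" where
  "oi_row2 n3 n4 t1 t4 =
     vector [2 * (n4 * t1 + 4 * t4), n3 * (4 - n4 * t1 * t4),
             4 * (4 * t1 * t4 - n4), 2 * n3 * (4 * t1 + n4 * t4)]"

text \<open>
  The same rows after substituting \<open>t\<^sub>i = 2 F\<^sub>i / (1 - F\<^sub>i\<^sup>2)\<close> and multiplying by
  \<open>(1 - F\<^sub>2\<^sup>2) (1 - F\<^sub>3\<^sup>2)\<close> and \<open>(1 - F\<^sub>1\<^sup>2) (1 - F\<^sub>4\<^sup>2)\<close>, respectively. These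
  make sense for all \<open>F\<^sub>i\<close>; for finite \<open>t\<^sub>i\<close> the factors are nonzero and hence irrelevant for the
  vanishing of the minors.
\<close>

definition oi_proj_row1 :: "real \<Rightarrow> real \<Rightarrow> real \<Rightarrow> real \<Rightarrow> real^4" where
  "oi_proj_row1 n1 n2 F2 F3 =
     (let p2 = 2 * F2; q2 = 1 - F2\<^sup>2; p3 = 2 * F3; q3 = 1 - F3\<^sup>2 in
      vector [2 * (4 * p2 * q3 + n2 * p3 * q2), 4 * (4 * p2 * p3 - n2 * q2 * q3),
              n1 * (4 * q2 * q3 - n2 * p2 * p3), 2 * n1 * (n2 * p2 * q3 + 4 * p3 * q2)])"

definition oi_proj_row2 :: "real \<Rightarrow> real \<Rightarrow> real \<Rightarrow> real \<Rightarrow> real^4" where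
  "oi_proj_row2 n3 n4 F1 F4 =
     (let p1 = 2 * F1; q1 = 1 - F1\<^sup>2; p4 = 2 * F4; q4 = 1 - F4\<^sup>2 in
      vector [2 * (n4 * p1 * q4 + 4 * p4 * q1), n3 * (4 * q1 * q4 - n4 * p1 * p4),
              4 * (4 * p1 * p4 - n4 * q1 * q4), 2 * n3 * (4 * p1 * q4 + n4 * p4 * q1)])"

lemma oi_proj_row1_eq:
  assumes "F2\<^sup>2 \<noteq> 1" "F3\<^sup>2 \<noteq> 1"
  shows "oi_proj_row1 n1 n2 F2 F3 =
    ((1 - F2\<^sup>2) * (1 - F3\<^sup>2)) *\<^sub>R oi_row1 n1 n2 (2 * F2 / (1 - F2\<^sup>2)) (2 * F3 / (1 - F3\<^sup>2))"
proof -
  define q2 where "q2 = 1 - F2\<^sup>2"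
  define q3 where "q3 = 1 - F3\<^sup>2"
  have q: "q2 \<noteq> 0" "q3 \<noteq> 0" using assms by (auto simp: q2_def q3_def)
  show ?thesis
    unfolding oi_proj_row1_def oi_row1_def q2_def[symmetric] q3_def[symmetric] Let_def
    using q by (simp add: vec_eq_iff forall_4 vector_def field_simps)
qed

lemma oi_proj_row2_eq:
  assumes "F1\<^sup>2 \<noteq> 1" "F4\<^sup>2 \<noteq> 1"
  shows "oi_proj_row2 n3 n4 F1 F4 =
    ((1 - F1\<^sup>2) * (1 - F4\<^sup>2)) *\<^sub>R oi_row2 n3 n4 (2 * F1 / (1 - F1\<^sup>2)) (2 * F4 / (1 - F4\<^sup>2))"
proof -
  define q1 where "q1 = 1 - F1\<^sup>2"
  define q4 where "q4 = 1 - F4\<^sup>2"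
  have q: "q1 \<noteq> 0" "q4 \<noteq> 0" using assms by (auto simp: q1_def q4_def)
  show ?thesis
    unfolding oi_proj_row2_def oi_row2_def q1_def[symmetric] q4_def[symmetric] Let_def
    using q by (simp add: vec_eq_iff forall_4 vector_def field_simps)
qed

definition minors_vanish :: "real^4 \<Rightarrow> real^4 \<Rightarrow> bool" where
  "minors_vanish r1 r2 \<longleftrightarrow> (\<forall>j k. r1 $ j * r2 $ k - r1 $ k * r2 $ j = 0)"

definition elliptic_OI :: "mesh \<Rightarrow> bool" where
  "elliptic_OI M \<longleftrightarrow>
     (\<forall>i. orthodiagonal (m_alpha M i) (m_beta M i) (m_gamma M i) (m_delta M i) \<and>
          elliptic (m_alpha M i) (m_beta M i) (m_gamma M i) (m_delta M i)) \<and>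
     (\<forall>i\<in>{2,4}.
        (m_F M i = 0 \<longrightarrow> m_lambda M (i-1) = m_lambda M i) \<and>
        (m_F M i \<noteq> 0 \<longrightarrow> m_lambda M (i-1) = -1 \<and> m_lambda M i = -1)) \<and>
     (\<forall>j\<in>{1,3}.
        (m_F M j = 0 \<longrightarrow> m_mu M (j-1) = m_mu M j) \<and>
        (m_F M j \<noteq> 0 \<longrightarrow> m_mu M (j-1) = -1 \<and> m_mu M j = -1)) \<and>
     minors_vanish (oi_proj_row1 (m_nu M 1) (m_nu M 2) (m_F M 2) (m_F M 3))
                   (oi_proj_row2 (m_nu M 3) (m_nu M 4) (m_F M 1) (m_F M 4))"

definition local_existence :: "mesh \<Rightarrow> bool" where
  "local_existence M \<longleftrightarrow>
     (\<forall>i. m_lambda M i < 0 \<or> m_mu M i < 0 \<or>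
          (m_lambda M i > 0 \<and> m_mu M i > 0 \<and> (m_nu M i)\<^sup>2 / (m_lambda M i * m_mu M i) > 16))"

end

theory Submission
  imports Defs
begin

text \<open>
  By (b), the two quadrilaterals along edge \<open>i\<close> share a constant \<open>k\<^sub>i\<close>. In the variables
  \<open>u\<^sub>i = x\<^sub>i + k\<^sub>i / x\<^sub>i\<close> and \<open>v\<^sub>i = y\<^sub>i + k\<^sub>i / y\<^sub>i\<close> the system becomes
  \<open>u\<^sub>1 u\<^sub>2 = \<nu>\<^sub>1\<close>, \<open>v\<^sub>2 v\<^sub>3 = \<nu>\<^sub>2\<close>, \<open>u\<^sub>3 u\<^sub>4 = \<nu>\<^sub>3\<close>, \<open>v\<^sub>4 v\<^sub>1 = \<nu>\<^sub>4\<close>, with each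
  \<open>v\<^sub>i\<close> a Moebius transform of \<open>u\<^sub>i\<close>. Condition (c) says that the composition of all these Moebius
  maps around the cycle is the identity, so over the \<open>u\<^sub>i\<close> there is always a one-parameter family,
  and the only obstruction is that \<open>x\<^sub>i\<close> be real: \<open>u\<^sub>i\<^sup>2 \<ge> 4 k\<^sub>i\<close> when \<open>k\<^sub>i > 0\<close>. If two
  adjacent \<open>k\<^sub>i\<close> are positive, local existence makes these constraints compatible on an interval.
  If exactly two opposite \<open>k\<^sub>i\<close> are positive, they confine \<open>u\<close> and \<open>v\<close> on the edge between
  them to two arcs of a circle, rotated against each other by the dihedral angle, and the inequality
  states that the arcs overlap in more than a point. Conversely, the configurations over a given
  value of any \<open>x\<^sub>i\<close> are finite in number, so a flexible mesh has a configuration at which all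
  these inequalities are strict.
\<close>

section \<open>The shift in the variables \<open>x + k / x\<close>\<close>

text \<open>
  For \<open>k = -1\<close> and \<open>x = tan (\<phi> / 2)\<close> one has \<open>x + k / x = - 2 cot \<phi>\<close>, so \<open>turn F\<close> is
  the addition theorem of the cotangent, cleared of denominators. For \<open>F = 0\<close> it is the identity,
  whatever \<open>k\<close>.
\<close>

definition turn :: "real \<Rightarrow> real \<Rightarrow> real \<Rightarrow> bool" where
  "turn F u v \<longleftrightarrow> (1 - F\<^sup>2) * (v - u) = F * (4 + u * v)"

lemma turn_commute: "turn (- F) v u \<longleftrightarrow> turn F u v"
  by (auto simp: turn_def algebra_simps)

lemma turn_0 [simp]: "turn 0 u v \<longleftrightarrow> u = v"
  by (auto simp: turn_def)

lemma turn_iff: "turn F u v \<longleftrightarrow> v * (1 - F\<^sup>2 - F * u) = (1 - F\<^sup>2) * u + 4 * F"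
  by (auto simp: turn_def algebra_simps)

text \<open>The numerator minus \<open>u\<close> times the denominator is
  \<open>F * (u\<^sup>2 + 4)\<close>, so both vanish only if \<open>F = 0\<close>, and then the
  denominator is \<open>1\<close>.\<close>

lemma turn_denominator_nonzero:
  assumes "turn F u v"
  shows "1 - F\<^sup>2 - F * u \<noteq> 0"
proof
  assume D: "1 - F\<^sup>2 - F * u = 0"
  with assms have N: "(1 - F\<^sup>2) * u + 4 * F = 0"
    by (simp add: turn_iff)
  have "F * (u\<^sup>2 + 4) = ((1 - F\<^sup>2) * u + 4 * F) - u * (1 - F\<^sup>2 - F * u)"
    by (simp add: algebra_simps power2_eq_square)
  also have "\<dots> = 0"
    using N D by simp
  finally have "F = 0"
    using zero_le_power2[of u] by (auto simp del: zero_le_power2)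
  with D show False
    by simp
qed

lemma turn_iff_divide:
  "turn F u v \<longleftrightarrow> 1 - F\<^sup>2 - F * u \<noteq> 0 \<and> v = ((1 - F\<^sup>2) * u + 4 * F) / (1 - F\<^sup>2 - F * u)"
  using turn_denominator_nonzero[of F u v] unfolding turn_iff by (auto simp: nonzero_eq_divide_eq)

lemma turn_unique: "turn F u v \<Longrightarrow> turn F u v' \<Longrightarrow> v = v'"
  by (simp add: turn_iff_divide)

lemma turn_unique': "turn F u v \<Longrightarrow> turn F u' v \<Longrightarrow> u = u'"
  using turn_unique[of "- F" v] by (simp add: turn_commute)

lemma finite_linear_zeros:
  fixes a b :: real
  assumes "a \<noteq> 0 \<or> b \<noteq> 0"
  shows "finite {u. a - b * u = 0}"
proof (rule finite_subset)
  show "{u. a - b * u = 0} \<subseteq> {a / b}"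
    using assms by (auto simp: field_simps)
qed simp

text \<open>Pulls a finite exclusion set back along one step of the cycle: to be avoided are the
  pole and at most one preimage of each forbidden \<open>v\<close>.\<close>

lemma finite_turn_obstruction:
  assumes "finite B"
  shows "finite {u. \<nexists>v. v \<notin> B \<and> turn F u v}"
proof (rule finite_subset)
  show "{u. \<nexists>v. v \<notin> B \<and> turn F u v} \<subseteq> {u. (1 - F\<^sup>2) - F * u = 0} \<union> (\<Union>v\<in>B. {u. turn F u v})"
    by (auto simp: turn_iff_divide)
  have "finite {u. turn F u v}" for v
  proof (cases "\<exists>w. turn F w v")
    case True
    then obtain w where "turn F w v" by blast
    then have "{u. turn F u v} \<subseteq> {w}" using turn_unique' by blast
    then show ?thesis by (rule finite_subset) simp
  qed simp
  moreover have "finite {u. (1 - F\<^sup>2) - F * u = 0}"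
    by (rule finite_linear_zeros) auto
  ultimately show "finite ({u. (1 - F\<^sup>2) - F * u = 0} \<union> (\<Union>v\<in>B. {u. turn F u v}))"
    using assms by simp
qed

lemma finite_inversion_obstruction:
  fixes n :: real
  assumes "finite B" "n \<noteq> 0"
  shows "finite {u. \<nexists>w. w \<notin> B \<and> u * w = n}"
proof (rule finite_subset)
  show "{u. \<nexists>w. w \<notin> B \<and> u * w = n} \<subseteq> insert 0 ((\<lambda>w. n / w) ` B)"
  proof
    fix u assume u: "u \<in> {u. \<nexists>w. w \<notin> B \<and> u * w = n}"
    show "u \<in> insert 0 ((\<lambda>w. n / w) ` B)"
    proof (cases "u = 0")
      case False
      with u have "n / u \<in> B" by auto
      moreover have "u = n / (n / u)" using False \<open>n \<noteq> 0\<close> by simp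
      ultimately show ?thesis by blast
    qed simp
  qed
qed (use assms in simp)

section \<open>The linearised system\<close>

text \<open>
  The variables are \<open>u i = x i + k i / x i\<close> and \<open>v i = y i + k i / y i\<close>; the constant \<open>k i\<close> is
  the coefficient shared by the two quadrilaterals in which the edge \<open>i\<close> takes part.
\<close>

definition linkage :: "(4 \<Rightarrow> real) \<Rightarrow> (4 \<Rightarrow> real) \<Rightarrow> (4 \<Rightarrow> real) \<Rightarrow> (4 \<Rightarrow> real) \<Rightarrow> bool" where
  "linkage n F u v \<longleftrightarrow>
     u 2 * u 1 = n 1 \<and> v 2 * v 3 = n 2 \<and> u 4 * u 3 = n 3 \<and> v 4 * v 1 = n 4 \<and>
     (\<forall>i. turn (F i) (u i) (v i))"

text \<open>Poles and zeros met along the cycle exclude finitely many values of \<open>u 2\<close>.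
  This is harmless later on, since the constraints on \<open>u 2\<close> define open sets.\<close>

definition generically_movable :: "(4 \<Rightarrow> real) \<Rightarrow> (4 \<Rightarrow> real) \<Rightarrow> bool" where
  "generically_movable n F \<longleftrightarrow> (\<exists>B. finite B \<and> (\<forall>a. a \<notin> B \<longrightarrow> (\<exists>u v. linkage n F u v \<and> u 2 = a)))"

lemma succ_4: "(1::4) + 1 = 2" "(2::4) + 1 = 3" "(3::4) + 1 = 4" "(4::4) + 1 = 1"
  by simp_all

text \<open>
  Shifting the indices by one exchanges the roles of \<open>x\<close> and \<open>y\<close>, hence of \<open>u\<close> and \<open>v\<close>.
\<close>

lemma linkage_rotate:
  "linkage (\<lambda>i. n (i + 1)) (\<lambda>i. - F (i + 1)) (\<lambda>i. v (i + 1)) (\<lambda>i. u (i + 1)) \<longleftrightarrow> linkage n F u v"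
  unfolding linkage_def forall_4 turn_commute succ_4 by (auto simp: mult.commute)

text \<open>After the rotation the free variable is \<open>v 3\<close>. It determines
  \<open>v 2\<close> and then \<open>u 2\<close>; since these relations are one-to-one, the solution
  through that \<open>u 2\<close> has the prescribed \<open>v 3\<close>.\<close>

lemma generically_movable_rotate:
  assumes "generically_movable n F" "n 2 \<noteq> 0"
  shows "generically_movable (\<lambda>i. n (i + 1)) (\<lambda>i. - F (i + 1))"
proof -
  obtain B where B: "finite B" "\<And>a. a \<notin> B \<Longrightarrow> \<exists>u v. linkage n F u v \<and> u 2 = a"
    using assms by (auto simp: generically_movable_def)
  define B1 where "B1 = {v2. \<nexists>u2. u2 \<notin> B \<and> turn (- F 2) v2 u2}"
  define B2 where "B2 = {v3. \<nexists>v2. v2 \<notin> B1 \<and> v3 * v2 = n 2}"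
  define B3 where "B3 = {u3. \<nexists>v3. v3 \<notin> B2 \<and> turn (F 3) u3 v3}"
  have "finite B2"
    unfolding B1_def B2_def using B(1) assms
    by (intro finite_inversion_obstruction finite_turn_obstruction)
  show ?thesis
    unfolding generically_movable_def
  proof (rule exI[of _ B2], intro conjI allI impI)
    show "finite B2" by fact
    fix v3 assume "v3 \<notin> B2"
    then obtain v2 where v2: "v2 \<notin> B1" "v3 * v2 = n 2"
      by (auto simp: B2_def)
    then obtain u2 where u2: "u2 \<notin> B" "turn (- F 2) v2 u2"
      by (auto simp: B1_def)
    then obtain u v where uv: "linkage n F u v" "u 2 = u2"
      using B(2) by blast
    then have "turn (F 2) u2 (v 2)" "v 2 * v 3 = n 2"
      by (auto simp: linkage_def)
    with u2(2) have "v 2 = v2"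
      by (simp add: turn_commute turn_unique)
    with \<open>v 2 * v 3 = n 2\<close> v2(2) assms(2) have "v 3 = v3"
      by (metis mult.commute mult_cancel_right mult_zero_right)
    then have "(\<lambda>i. v (i + 1)) 2 = v3"
      by (simp only: succ_4)
    moreover have "linkage (\<lambda>i. n (i + 1)) (\<lambda>i. - F (i + 1)) (\<lambda>i. v (i + 1)) (\<lambda>i. u (i + 1))"
      using uv(1) by (rule linkage_rotate[THEN iffD2])
    ultimately show "\<exists>u v. linkage (\<lambda>i. n (i + 1)) (\<lambda>i. - F (i + 1)) u v \<and> u 2 = v3"
      by blast
  qed
qed

text \<open>For nonzero \<open>k\<close> this says that \<open>x\<^sup>2 - u * x + k\<close> has two
  distinct real roots; strictness makes the condition stable under small perturbations.\<close>

definition admissible :: "real \<Rightarrow> real \<Rightarrow> bool" where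
  "admissible k u \<longleftrightarrow> k < 0 \<or> u\<^sup>2 > 4 * k"

definition realizable :: "(4 \<Rightarrow> real) \<Rightarrow> (4 \<Rightarrow> real) \<Rightarrow> (4 \<Rightarrow> real) \<Rightarrow> bool" where
  "realizable n F k \<longleftrightarrow> (\<exists>u v. linkage n F u v \<and> (\<forall>i. admissible (k i) (u i)))"

lemma admissible_turn:
  assumes "turn F u v" "F \<noteq> 0 \<longrightarrow> k < 0"
  shows "admissible k u \<longleftrightarrow> admissible k v"
  using assms by (cases "F = 0") (auto simp: admissible_def)

lemma all_shift: "(\<forall>i::4. P (i + 1)) \<longleftrightarrow> (\<forall>i. P i)"
  unfolding forall_4 succ_4 by blast

lemma realizable_rotate:
  assumes "realizable (\<lambda>i. n (i + 1)) (\<lambda>i. - F (i + 1)) (\<lambda>i. k (i + 1))"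
    and "\<forall>i. F i \<noteq> 0 \<longrightarrow> k i < 0"
  shows "realizable n F k"
proof -
  obtain u v where uv: "linkage (\<lambda>i. n (i + 1)) (\<lambda>i. - F (i + 1)) u v" 
    and adm: "\<forall>i. admissible (k (i + 1)) (u i)"
    using assms by (auto simp: realizable_def)
  define u' v' where "u' = (\<lambda>i. v (i - 1))" and "v' = (\<lambda>i. u (i - 1))"
  have "linkage n F u' v'"
    using uv linkage_rotate[of n F v' u'] by (simp add: u'_def v'_def)
  moreover have "\<forall>i. admissible (k i) (v' i)"
    using adm all_shift[of "\<lambda>i. admissible (k i) (v' i)"] by (simp add: v'_def)
  ultimately show ?thesis
    using assms(2) admissible_turn unfolding realizable_def linkage_def by blast
qed

text \<open>
  Each row of the matrix lists the coefficients of the bilinear relation between \<open>u\<^sub>1\<close> and \<open>u\<^sub>3\<close>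
  imposed by two adjacent quadrilaterals. The relation of the first row is a nondegenerate
  correspondence, so the row does not vanish and the second row is a multiple of it.
\<close>

lemma turn_closes:
  assumes minors: "minors_vanish (oi_proj_row1 n1 n2 F2 F3) (oi_proj_row2 n3 n4 F1 F4)"
    and nz: "n1 \<noteq> 0" "n2 \<noteq> 0" "n3 \<noteq> 0" "n4 \<noteq> 0"
    and u: "u2 * u1 = n1" "u4 * u3 = n3"
    and v: "v2 * v3 = n2" "v4 * v1 = n4"
    and turns: "turn F2 u2 v2" "turn F3 u3 v3" "turn F4 u4 v4"
  shows "turn F1 u1 v1"
proof -
  define q1 where "q1 = 1 - F1\<^sup>2"
  define q2 where "q2 = 1 - F2\<^sup>2"
  define q3 where "q3 = 1 - F3\<^sup>2"
  define q4 where "q4 = 1 - F4\<^sup>2"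
  note q = q1_def[symmetric] q2_def[symmetric] q3_def[symmetric] q4_def[symmetric]
  have t: "v2 * (q2 - F2 * u2) = q2 * u2 + 4 * F2" "v3 * (q3 - F3 * u3) = q3 * u3 + 4 * F3"
    "v4 * (q4 - F4 * u4) = q4 * u4 + 4 * F4"
    using turns by (simp_all add: turn_iff q)
  have D4: "q4 - F4 * u4 \<noteq> 0"
    using turn_denominator_nonzero[OF turns(3)] by (simp add: q)
  define r where "r = (\<lambda>j. oi_proj_row1 n1 n2 F2 F3 $ j)"
  define s where "s = (\<lambda>j. oi_proj_row2 n3 n4 F1 F4 $ j)"
  have r: "r 1 = 4 * (4 * F2 * q3 + n2 * F3 * q2)" "r 2 = 4 * (16 * F2 * F3 - n2 * q2 * q3)"
    "r 3 = 4 * n1 * (q2 * q3 - n2 * F2 * F3)" "r 4 = 4 * n1 * (n2 * F2 * q3 + 4 * F3 * q2)"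
    by (simp_all add: r_def oi_proj_row1_def vector_def q Let_def algebra_simps)
  have s: "s 1 = 4 * (n4 * F1 * q4 + 4 * F4 * q1)" "s 2 = 4 * n3 * (q1 * q4 - n4 * F1 * F4)"
    "s 3 = 4 * (16 * F1 * F4 - n4 * q1 * q4)" "s 4 = 4 * n3 * (4 * F1 * q4 + n4 * F4 * q1)"
    by (simp_all add: s_def oi_proj_row2_def vector_def q Let_def algebra_simps)
  define form where "form = (\<lambda>c :: 4 \<Rightarrow> real. c 1 * (u1 * u3) + c 2 * u1 + c 3 * u3 + c 4)"
  \<comment> \<open>The factor \<open>u1\<close> eliminates \<open>u2\<close> through
    \<open>u2 * u1 = n1\<close>; the rest combines the turn equations at edges 2 and 3.\<close>
  have "form r = 4 * u1 * ((q2 * u2 + 4 * F2) * (q3 * u3 + 4 * F3)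
      - (v2 * v3) * ((q2 - F2 * u2) * (q3 - F3 * u3)))"
    unfolding form_def r v(1) u(1)[symmetric] by algebra
  also have "\<dots> = 0"
    unfolding t[symmetric] by simp
  finally have form_r: "form r = 0" .
  \<comment> \<open>The determinant of the bilinear form is multiplicative: each turn contributes
    \<open>(1 + F\<^sup>2)\<^sup>2\<close>.\<close>
  have "r 1 * r 4 - r 2 * r 3 = 16 * n1 * n2 * ((q2\<^sup>2 + 4 * F2\<^sup>2) * (q3\<^sup>2 + 4 * F3\<^sup>2))"
    unfolding r by algebra
  moreover have "(1 - F\<^sup>2)\<^sup>2 + 4 * F\<^sup>2 = (1 + F\<^sup>2)\<^sup>2" for F :: real
    by algebra
  moreover have "1 + F\<^sup>2 \<noteq> 0" for F :: real
    by (smt (verit) zero_le_power2)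
  ultimately have "r 1 * r 4 - r 2 * r 3 \<noteq> 0"
    using nz by (simp add: q2_def q3_def)
  then obtain j where j: "r j \<noteq> 0"
    by fastforce
  have "r j * s l = s j * r l" for l
    using minors by (simp add: minors_vanish_def r_def s_def mult.commute)
  from this[of 1] this[of 2] this[of 3] this[of 4] have "r j * form s = s j * form r"
    unfolding form_def by algebra
  with j form_r have "form s = 0"
    by simp
  moreover have "form s = 4 * u3 * ((q4 * u4 + 4 * F4) * (q1 * u1 + 4 * F1)
      - (v4 * v1) * ((q4 - F4 * u4) * (q1 - F1 * u1)))"
    unfolding form_def s v(2) u(2)[symmetric] by algebra
  \<comment> \<open>Up to nonzero factors, the second relation is the turn equation at edge
    1.\<close>
  moreover have "\<dots> = 4 * u3 * v4 * (q4 - F4 * u4) * ((q1 * u1 + 4 * F1) - v1 * (q1 - F1 * u1))"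
    unfolding t[symmetric] by algebra
  ultimately have "(q1 * u1 + 4 * F1) - v1 * (q1 - F1 * u1) = 0"
    using nz u v D4 by auto
  then show ?thesis
    by (simp add: turn_iff q)
qed

text \<open>Following \<open>u2\<close>, \<open>v2\<close>, \<open>v3\<close>, \<open>u3\<close>,
  \<open>u4\<close>, \<open>v4\<close> around the cycle solves everything except the turn at edge 1,
  which \<open>turn_closes\<close> supplies.\<close>

lemma generically_movable_if_minors_vanish:
  assumes "minors_vanish (oi_proj_row1 (n 1) (n 2) (F 2) (F 3)) (oi_proj_row2 (n 3) (n 4) (F 1) (F 4))"
    and nz: "\<forall>i. n i \<noteq> 0"
  shows "generically_movable n F"
proof -
  \<comment> \<open>The exclusion sets are built backwards from the end of the chain, where
    \<open>v4\<close> has to be nonzero for \<open>v1 = n 4 / v4\<close>.\<close>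
  define B4 where "B4 = {u4. \<nexists>v4. v4 \<notin> {0} \<and> turn (F 4) u4 v4}"
  define B3 where "B3 = {u3. \<nexists>u4. u4 \<notin> B4 \<and> u3 * u4 = n 3}"
  define B3' where "B3' = {v3. \<nexists>u3. u3 \<notin> B3 \<and> turn (- F 3) v3 u3}"
  define B2' where "B2' = {v2. \<nexists>v3. v3 \<notin> B3' \<and> v2 * v3 = n 2}"
  define B2 where "B2 = {u2. \<nexists>v2. v2 \<notin> B2' \<and> turn (F 2) u2 v2}"
  have "finite B2"
    unfolding B2_def B2'_def B3'_def B3_def B4_def using nz
    by (intro finite_inversion_obstruction finite_turn_obstruction) auto
  show ?thesis
    unfolding generically_movable_def
  proof (rule exI[of _ "insert 0 B2"], intro conjI allI impI)
    show "finite (insert 0 B2)" using \<open>finite B2\<close> by simp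
    fix u2 assume u2: "u2 \<notin> insert 0 B2"
    then obtain v2 where v2: "v2 \<notin> B2'" "turn (F 2) u2 v2"
      by (auto simp: B2_def)
    then obtain v3 where v3: "v3 \<notin> B3'" "v2 * v3 = n 2"
      by (auto simp: B2'_def)
    then obtain u3 where u3: "u3 \<notin> B3" "turn (F 3) u3 v3"
      by (auto simp: B3'_def turn_commute)
    then obtain u4 where u4: "u4 \<notin> B4" "u4 * u3 = n 3"
      by (auto simp: B3_def mult.commute)
    then obtain v4 where v4: "v4 \<noteq> 0" "turn (F 4) u4 v4"
      by (auto simp: B4_def)
    define u1 where "u1 = n 1 / u2"
    define v1 where "v1 = n 4 / v4"
    have n: "u2 * u1 = n 1" "v4 * v1 = n 4"
      using u2 v4 by (auto simp: u1_def v1_def)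
    have "turn (F 1) u1 v1"
      using turn_closes[OF assms(1)] nz n u4(2) v3(2) v2(2) u3(2) v4(2) by blast
    define u :: "4 \<Rightarrow> real" where "u i = (if i = 1 then u1 else if i = 2 then u2 else if i = 3 then u3 else u4)" for i
    define v :: "4 \<Rightarrow> real" where "v i = (if i = 1 then v1 else if i = 2 then v2 else if i = 3 then v3 else v4)" for i
    have "u 1 = u1" "u 2 = u2" "u 3 = u3" "u 4 = u4" "v 1 = v1" "v 2 = v2" "v 3 = v3" "v 4 = v4"
      by (simp_all add: u_def v_def)
    then have "linkage n F u v \<and> u 2 = u2"
      using n u4(2) v3(2) v2(2) u3(2) v4(2) \<open>turn (F 1) u1 v1\<close>
      unfolding linkage_def forall_4 by metis
    then show "\<exists>u v. linkage n F u v \<and> u 2 = u2" by blast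
  qed
qed

section \<open>Real points of the linearised system\<close>

lemma open_avoids_finite:
  fixes S :: "real set"
  assumes "open S" "x \<in> S" "finite B"
  obtains y where "y \<in> S" "y \<notin> B"
proof -
  obtain e where e: "e > 0" "ball x e \<subseteq> S"
    using assms open_contains_ball by blast
  have "infinite (ball x e)"
    using e(1) by (simp add: ball_eq_greaterThanLessThan infinite_Ioo)
  then obtain y where "y \<in> ball x e - B"
    using assms(3) by (metis Diff_infinite_finite all_not_in_conv finite.emptyI)
  then show thesis using e that by auto
qed

text \<open>
  With \<open>F = tan (\<theta> / 2)\<close>, this says that the arcs \<open>\<bar>cot \<phi>\<bar> < A\<close> and
  \<open>\<bar>cot (\<phi> + \<theta>)\<bar> < B\<close> of directions \<open>\<phi>\<close> modulo \<open>\<pi>\<close> meet. The denominator of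
  \<open>tan \<theta> = 2 F / (1 - F\<^sup>2)\<close> is cleared in order to cover \<open>\<theta> = \<pi> / 2\<close>.
\<close>

definition arcs_overlap :: "real \<Rightarrow> real \<Rightarrow> real \<Rightarrow> bool" where
  "arcs_overlap A B F \<longleftrightarrow> F = 0 \<or> 2 * \<bar>F\<bar> * (1 - A * B) < \<bar>1 - F\<^sup>2\<bar> * (A + B)"

lemma arcs_overlap_uminus [simp]: "arcs_overlap A B (- F) \<longleftrightarrow> arcs_overlap A B F"
  by (simp add: arcs_overlap_def)

lemma arcs_overlap_commute: "arcs_overlap A B F \<longleftrightarrow> arcs_overlap B A F"
  by (simp add: arcs_overlap_def mult.commute add.commute)

text \<open>Shrinking overlapping arcs by a common factor makes them touch at end points, and the
  point of contact lies inside the original arcs. For the converse, absolute values are taken in the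
  equation of \<open>turn\<close>.\<close>

lemma arcs_overlap_iff:
  assumes "A > 0" "B > 0"
  shows "arcs_overlap A B F \<longleftrightarrow> (\<exists>u v. turn F u v \<and> \<bar>u\<bar> < 2 * A \<and> \<bar>v\<bar> < 2 * B)"
proof
  assume ov: "arcs_overlap A B F"
  show "\<exists>u v. turn F u v \<and> \<bar>u\<bar> < 2 * A \<and> \<bar>v\<bar> < 2 * B"
  proof (cases "F = 0")
    case True
    then show ?thesis using assms by (intro exI[of _ 0]) simp
  next
    case False
    \<comment> \<open>\<open>f r\<close> measures the overlap of the arcs shrunk by
      \<open>r\<close>; its zero is the moment of contact.\<close>
    define f where "f r = \<bar>1 - F\<^sup>2\<bar> * r * (A + B) - 2 * \<bar>F\<bar> * (1 - r\<^sup>2 * (A * B))" for r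
    have "f 0 < 0" "f 1 > 0"
      using False ov by (auto simp: f_def arcs_overlap_def)
    moreover have "continuous_on {0..1} f"
      unfolding f_def by (intro continuous_intros)
    ultimately obtain r where r: "0 \<le> r" "r \<le> 1" "f r = 0"
      using IVT'[of f 0 0 1] by auto
    with \<open>f 1 > 0\<close> have "r < 1"
      by (cases "r = 1") auto
    \<comment> \<open>The sign of \<open>F * (1 - F\<^sup>2)\<close> tells which pair of opposite
      ends meets.\<close>
    define \<sigma> :: real where "\<sigma> = (if F * (1 - F\<^sup>2) \<ge> 0 then 1 else -1)"
    have \<sigma>: "\<sigma> * \<sigma> = 1" "\<bar>\<sigma>\<bar> = 1"
      by (auto simp: \<sigma>_def)
    have sgn: "\<sigma> * (1 - F\<^sup>2) * \<bar>F\<bar> = \<bar>1 - F\<^sup>2\<bar> * F"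
    proof -
      have "(if F * X \<ge> 0 then 1 else - 1) * X * \<bar>F\<bar> = \<bar>X\<bar> * F" for X
        by (cases "F \<ge> 0"; cases "X \<ge> 0") (auto simp: zero_le_mult_iff)
      then show ?thesis by (simp only: \<sigma>_def)
    qed
    have "\<bar>F\<bar> * (\<sigma> * (1 - F\<^sup>2) * r * (A + B)) = F * (\<bar>1 - F\<^sup>2\<bar> * r * (A + B))"
      using sgn by algebra
    also have "\<dots> = \<bar>F\<bar> * (2 * F * (1 - r\<^sup>2 * (A * B)))"
      using r(3) by (simp add: f_def)
    finally have "\<sigma> * (1 - F\<^sup>2) * r * (A + B) = 2 * F * (1 - r\<^sup>2 * (A * B))"
      using False by simp
    then have "turn F (- 2 * \<sigma> * r * A) (2 * \<sigma> * r * B)"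
      unfolding turn_def using \<sigma>(1) by algebra
    moreover have "\<bar>- 2 * \<sigma> * r * A\<bar> < 2 * A" "\<bar>2 * \<sigma> * r * B\<bar> < 2 * B"
      using \<sigma>(2) r \<open>r < 1\<close> assms by (simp_all add: abs_mult)
    ultimately show ?thesis by blast
  qed
next
  assume "\<exists>u v. turn F u v \<and> \<bar>u\<bar> < 2 * A \<and> \<bar>v\<bar> < 2 * B"
  then obtain u v where uv: "turn F u v" "\<bar>u\<bar> < 2 * A" "\<bar>v\<bar> < 2 * B" by blast
  show "arcs_overlap A B F"
  proof (cases "F = 0")
    case False
    have "\<bar>u\<bar> * \<bar>v\<bar> < (2 * A) * (2 * B)"
      using uv by (intro mult_strict_mono') auto
    then have "\<bar>u * v\<bar> < 4 * (A * B)"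
      by (simp add: abs_mult)
    then have "- (4 * (A * B)) < u * v"
      by (simp only: abs_less_iff minus_less_iff)
    then have "4 * (1 - A * B) < 4 + u * v"
      by (simp add: algebra_simps)
    then have "4 * (1 - A * B) < \<bar>4 + u * v\<bar>"
      by (rule less_le_trans) simp
    then have "\<bar>F\<bar> * (4 * (1 - A * B)) < \<bar>F * (4 + u * v)\<bar>"
      unfolding abs_mult using False by (intro mult_strict_left_mono) auto
    also have "\<dots> = \<bar>1 - F\<^sup>2\<bar> * \<bar>v - u\<bar>"
      using uv(1) by (simp add: turn_def abs_mult[symmetric])
    also have "\<dots> \<le> \<bar>1 - F\<^sup>2\<bar> * (2 * (A + B))"
      using uv by (intro mult_left_mono) auto
    finally have "2 * (2 * \<bar>F\<bar> * (1 - A * B)) < 2 * (\<bar>1 - F\<^sup>2\<bar> * (A + B))"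
      by (simp only: mult.assoc mult.left_commute)
    then show ?thesis
      by (simp only: arcs_overlap_def mult_less_cancel_left_pos zero_less_numeral simp_thms)
  qed (simp add: arcs_overlap_def)
qed

text \<open>Half of the bound on \<open>\<bar>u\<bar>\<close> that keeps
  \<open>\<bar>n / u\<bar>\<close> above \<open>2 * sqrt k\<close>. The 2 is split off because
  \<open>arcs_overlap\<close> measures cotangents, while \<open>x - 1 / x\<close> is
  \<open>- 2 cot \<phi>\<close>.\<close>

definition half_window :: "real \<Rightarrow> real \<Rightarrow> real" where
  "half_window n k = \<bar>n\<bar> / (4 * sqrt k)"

lemma half_window_pos: "n \<noteq> 0 \<Longrightarrow> k > 0 \<Longrightarrow> half_window n k > 0"
  by (simp add: half_window_def)

lemma half_window_iff:
  assumes "u * w = n" "n \<noteq> 0" "k > 0"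
  shows "\<bar>u\<bar> < 2 * half_window n k \<longleftrightarrow> w\<^sup>2 > 4 * k"
proof -
  have "u \<noteq> 0" using assms by auto
  have "\<bar>u\<bar> < 2 * half_window n k \<longleftrightarrow> \<bar>u\<bar> * (2 * sqrt k) < \<bar>u\<bar> * \<bar>w\<bar>"
    unfolding half_window_def assms(1)[symmetric] abs_mult using assms(3) by (simp add: field_simps)
  also have "\<dots> \<longleftrightarrow> 2 * sqrt k < \<bar>w\<bar>"
    using \<open>u \<noteq> 0\<close> by simp
  also have "\<dots> \<longleftrightarrow> (2 * sqrt k)\<^sup>2 < w\<^sup>2"
    using abs_le_square_iff[of w "2 * sqrt k"] assms(3) by (auto simp: not_le[symmetric])
  also have "\<dots> \<longleftrightarrow> w\<^sup>2 > 4 * k"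
    using assms by (simp add: power_mult_distrib)
  finally show ?thesis .
qed

text \<open>Phrased per edge, so that it is stable under rotation of the indices. Since
  \<open>n i\<close> couples the edges \<open>i\<close> and \<open>i + 1\<close>, the last clause is
  local existence at their common corner.\<close>

definition feasible :: "(4 \<Rightarrow> real) \<Rightarrow> (4 \<Rightarrow> real) \<Rightarrow> (4 \<Rightarrow> real) \<Rightarrow> bool" where
  "feasible n F k \<longleftrightarrow> generically_movable n F \<and>
     (\<forall>i. n i \<noteq> 0) \<and> (\<forall>i. k i \<noteq> 0) \<and> (\<forall>i. F i \<noteq> 0 \<longrightarrow> k i < 0) \<and>
     (\<forall>i. k i > 0 \<and> k (i + 1) > 0 \<longrightarrow> 16 * k i * k (i + 1) < (n i)\<^sup>2)"

lemma feasible_rotate: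
  assumes "feasible n F k"
  shows "feasible (\<lambda>i. n (i + 1)) (\<lambda>i. - F (i + 1)) (\<lambda>i. k (i + 1))"
proof -
  have "k (i + 1) > 0 \<and> k (i + 1 + 1) > 0 \<longrightarrow> 16 * k (i + 1) * k (i + 1 + 1) < (n (i + 1))\<^sup>2" for i
    using assms unfolding feasible_def by blast
  then show ?thesis
    using assms generically_movable_rotate[of n F] unfolding feasible_def by auto
qed

lemma exists_square_between:
  fixes a b :: real
  assumes "0 \<le> a" "a < b" "finite B"
  obtains u where "a < u\<^sup>2" "u\<^sup>2 < b" "u \<notin> B"
proof -
  have "open {u. a < u\<^sup>2 \<and> u\<^sup>2 < b}"
    by (intro open_Collect_conj open_Collect_less continuous_intros)
  moreover have "sqrt ((a + b) / 2) \<in> {u. a < u\<^sup>2 \<and> u\<^sup>2 < b}"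
    using assms by (simp add: field_simps)
  ultimately show thesis
    using open_avoids_finite[OF _ _ assms(3)] that by blast
qed

lemma square_of_quotient:
  fixes u w n k :: real
  assumes "u * w = n" "k > 0" "u\<^sup>2 < n\<^sup>2 / (4 * k)"
  shows "w\<^sup>2 > 4 * k"
proof -
  have "u\<^sup>2 * (4 * k) < u\<^sup>2 * w\<^sup>2"
    using assms by (auto simp: field_simps power_mult_distrib)
  then show ?thesis
    by (rule mult_left_less_imp_less) simp
qed

text \<open>Edge 4 imposes nothing, and the other constraints can be read on edge 2: positive
  coefficients on edges 1 and 3 bound \<open>\<bar>u 2\<bar>\<close> and
  \<open>\<bar>v 2\<bar>\<close> from above, one on edge 2 bounds them from below.\<close>

lemma realizable_negative:
  assumes "feasible n F k" "k 4 < 0"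
    and ov: "k 2 < 0 \<Longrightarrow> k 1 > 0 \<Longrightarrow> k 3 > 0 \<Longrightarrow>
      arcs_overlap (half_window (n 1) (k 1)) (half_window (n 2) (k 3)) (F 2)"
  shows "realizable n F k"
proof -
  have n: "\<And>i. n i \<noteq> 0" and k: "\<And>i. k i \<noteq> 0" and F: "\<And>i. k i > 0 \<Longrightarrow> F i = 0"
    and adj: "\<And>i. k i > 0 \<Longrightarrow> k (i + 1) > 0 \<Longrightarrow> 16 * k i * k (i + 1) < (n i)\<^sup>2"
    using assms(1) unfolding feasible_def by (auto dest: order.asym)
  obtain B where B: "finite B" "\<And>a. a \<notin> B \<Longrightarrow> \<exists>u v. linkage n F u v \<and> u 2 = a"
    using assms(1) by (auto simp: feasible_def generically_movable_def)
  show ?thesis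
  proof (cases "k 2 < 0")
    case True
    define w1 where "w1 = half_window (n 1) (k 1)"
    define w3 where "w3 = half_window (n 2) (k 3)"
    have w: "k 1 > 0 \<Longrightarrow> w1 > 0" "k 3 > 0 \<Longrightarrow> w3 > 0"
      using n by (simp_all add: w1_def w3_def half_window_pos)
    \<comment> \<open>An edge with negative coefficient has no window; a substitute making the
      product of the two windows \<open>2\<close> renders the overlap automatic.\<close>
    have large: "arcs_overlap A C (F 2)" if "A > 0" "C > 0" "A * C = 2" for A C
    proof -
      have "0 \<le> \<bar>1 - (F 2)\<^sup>2\<bar> * (A + C)" using that by simp
      then show ?thesis using that by (cases "F 2 = 0") (auto simp: arcs_overlap_def intro: less_le_trans[of _ 0])
    qed
    obtain A C where AC: "A > 0" "C > 0" "arcs_overlap A C (F 2)"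
      and A: "k 1 > 0 \<Longrightarrow> A = w1" and C: "k 3 > 0 \<Longrightarrow> C = w3"
    proof (cases "k 1 > 0"; cases "k 3 > 0")
      assume "k 1 > 0" "k 3 > 0"
      then show thesis using that[of w1 w3] w ov True by (simp add: w1_def w3_def)
    next
      assume "k 1 > 0" "\<not> k 3 > 0"
      then show thesis using that[of w1 "2 / w1"] w large[of w1 "2 / w1"] by simp
    next
      assume "\<not> k 1 > 0" "k 3 > 0"
      then show thesis using that[of "2 / w3" w3] w large[of "2 / w3" w3] by simp
    next
      assume "\<not> k 1 > 0" "\<not> k 3 > 0"
      then show thesis using that[of 1 2] large[of 1 2] by simp
    qed
    obtain a b where ab: "turn (F 2) a b" "\<bar>a\<bar> < 2 * A" "\<bar>b\<bar> < 2 * C"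
      using AC arcs_overlap_iff by blast
    define D where "D = (\<lambda>u. 1 - (F 2)\<^sup>2 - F 2 * u)"
    define N where "N = (\<lambda>u. (1 - (F 2)\<^sup>2) * u + 4 * F 2)"
    have turn_N: "\<bar>N u\<bar> = \<bar>v\<bar> * \<bar>D u\<bar> \<and> \<bar>D u\<bar> > 0" if "turn (F 2) u v" for u v
      using that turn_denominator_nonzero[OF that]
      by (simp add: turn_iff D_def N_def abs_mult[symmetric])
    \<comment> \<open>The bound on \<open>\<bar>v 2\<bar>\<close> is multiplied by the denominator,
      so that openness is immediate even near the pole.\<close>
    define S where "S = {u. \<bar>u\<bar> < 2 * A \<and> \<bar>N u\<bar> < 2 * C * \<bar>D u\<bar>}"
    have "open S"
      unfolding S_def D_def N_def by (intro open_Collect_conj open_Collect_less continuous_intros)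
    moreover have "a \<in> S"
      using ab turn_N[OF ab(1)] by (simp add: S_def)
    ultimately obtain c where c: "c \<in> S" "c \<notin> B"
      using open_avoids_finite B(1) by blast
    then obtain u v where uv: "linkage n F u v" "u 2 = c"
      using B(2) by blast
    then have "turn (F 2) c (v 2)" by (auto simp: linkage_def)
    then have "\<bar>v 2\<bar> < 2 * C"
      using turn_N[of c "v 2"] c(1) by (simp add: S_def)
    then have "k 3 > 0 \<Longrightarrow> (v 3)\<^sup>2 > 4 * k 3"
      using uv n C half_window_iff[of "v 2" "v 3" "n 2" "k 3"] by (simp add: linkage_def w3_def)
    moreover have "k 3 > 0 \<Longrightarrow> u 3 = v 3"
      using uv F[of 3] by (metis linkage_def turn_0)
    moreover have "k 1 > 0 \<Longrightarrow> (u 1)\<^sup>2 > 4 * k 1"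
      using uv n A c(1) half_window_iff[of "u 2" "u 1" "n 1" "k 1"] by (simp add: linkage_def w1_def S_def)
    ultimately have "\<forall>i. admissible (k i) (u i)"
      using True assms(2) k[of 1, unfolded neq_iff] k[of 3, unfolded neq_iff] by (auto simp: forall_4 admissible_def)
    then show ?thesis using uv(1) by (auto simp: realizable_def)
  next
    case False
    then have k2: "k 2 > 0" using k[of 2] by simp
    \<comment> \<open>\<open>4 * k 2 + 1\<close> stands in for an absent upper bound; anything above
      \<open>4 * k 2\<close> would do.\<close>
    define b1 where "b1 = (if k 1 > 0 then (n 1)\<^sup>2 / (4 * k 1) else 4 * k 2 + 1)"
    define b3 where "b3 = (if k 3 > 0 then (n 2)\<^sup>2 / (4 * k 3) else 4 * k 2 + 1)"
    have "4 * k 2 < b1"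
      using adj[of 1] k2 unfolding succ_4 by (simp add: b1_def field_simps)
    moreover have "4 * k 2 < b3"
      using adj[of 2] k2 unfolding succ_4 by (simp add: b3_def field_simps)
    ultimately have "4 * k 2 < min b1 b3" by simp
    then obtain c where c: "4 * k 2 < c\<^sup>2" "c\<^sup>2 < min b1 b3" "c \<notin> B"
      using exists_square_between[of "4 * k 2" "min b1 b3" B] k2 B(1) by (metis less_imp_le mult_pos_pos zero_less_numeral)
    then obtain u v where uv: "linkage n F u v" "u 2 = c"
      using B(2) by blast
    have "v 2 = c" 
      using uv F[OF k2] by (metis linkage_def turn_0)
    have "k 3 > 0 \<Longrightarrow> u 3 = v 3"
      using uv F[of 3] by (metis linkage_def turn_0)
    moreover have "k 3 > 0 \<Longrightarrow> (v 3)\<^sup>2 > 4 * k 3"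
      using square_of_quotient[of c "v 3" "n 2" "k 3"] uv(1) \<open>v 2 = c\<close> c(2)
      by (simp add: linkage_def b3_def)
    moreover have "k 1 > 0 \<Longrightarrow> (u 1)\<^sup>2 > 4 * k 1"
      using square_of_quotient[of c "u 1" "n 1" "k 1"] uv c(2)
      by (simp add: linkage_def b1_def)
    ultimately have "\<forall>i. admissible (k i) (u i)"
      using c(1) uv(2) assms(2) k[of 1, unfolded neq_iff] k[of 3, unfolded neq_iff] by (auto simp: forall_4 admissible_def)
    then show ?thesis using uv(1) by (auto simp: realizable_def)
  qed
qed

text \<open>All \<open>F i\<close> vanish, so everything is governed by
  \<open>(u 2)\<^sup>2\<close>: edges 2 and 4 bound it from below, edges 1 and 3 from above. Local
  existence at the corner of two edges compares their bounds.\<close>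

lemma realizable_all_positive:
  assumes "feasible n F k" "\<forall>i. k i > 0"
  shows "realizable n F k"
proof -
  have n: "\<And>i. n i \<noteq> 0" and k: "\<And>i. k i > 0" and F: "\<And>i. F i = 0"
    and adj: "\<And>i. 16 * k i * k (i + 1) < (n i)\<^sup>2"
    using assms unfolding feasible_def by (auto, metis order.asym)
  obtain B where B: "finite B" "\<And>a. a \<notin> B \<Longrightarrow> \<exists>u v. linkage n F u v \<and> u 2 = a"
    using assms(1) by (auto simp: feasible_def generically_movable_def)
  have link: "u 2 * u 1 = n 1 \<and> u 2 * u 3 = n 2 \<and> u 4 * u 3 = n 3 \<and> u 4 * u 1 = n 4"
    if "linkage n F u v" for u v
  proof -
    have "\<forall>i. u i = v i"
      using that F by (simp add: linkage_def)
    then show ?thesis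
      using that by (simp add: linkage_def)
  qed
  obtain a where "a \<notin> B"
    using ex_new_if_finite[OF infinite_UNIV_char_0 B(1)] by blast
  then obtain u v where uv: "linkage n F u v"
    using B(2) by blast
  \<comment> \<open>Multiplying around the cycle in any one solution yields the relation among the
    \<open>n i\<close> needed at the corner of edges 4 and 1.\<close>
  have "(u 2 * u 1) * (u 4 * u 3) = (u 2 * u 3) * (u 4 * u 1)"
    by simp
  then have n4: "n 1 * n 3 = n 2 * n 4"
    unfolding link[OF uv, THEN conjunct1] using link[OF uv] by simp
  have pos: "(n i)\<^sup>2 > 0" for i using n by simp
  define a2 where "a2 = 4 * k 2"
  \<comment> \<open>This bound comes from \<open>u 4 = n 3 * u 2 / n 2\<close>.\<close>
  define a4 where "a4 = 4 * k 4 * (n 2)\<^sup>2 / (n 3)\<^sup>2"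
  define b1 where "b1 = (n 1)\<^sup>2 / (4 * k 1)"
  define b3 where "b3 = (n 2)\<^sup>2 / (4 * k 3)"
  have "a2 < b1"
    using adj[of 1] k[of 1] unfolding succ_4 a2_def b1_def by (simp add: field_simps)
  moreover have "a2 < b3"
    using adj[of 2] k[of 3] unfolding succ_4 a2_def b3_def by (simp add: field_simps)
  moreover have "a4 < b3"
  proof -
    have "(n 2)\<^sup>2 * (16 * k 3 * k 4) < (n 2)\<^sup>2 * (n 3)\<^sup>2"
      using adj[of 3] pos unfolding succ_4 by (intro mult_strict_left_mono) auto
    then show ?thesis
      using k[of 3] pos[of 3] unfolding a4_def b3_def by (simp add: field_simps)
  qed
  moreover have "a4 < b1"
  proof -
    have "(n 2)\<^sup>2 * (16 * k 4 * k 1) < (n 2)\<^sup>2 * (n 4)\<^sup>2"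
      using adj[of 4] pos unfolding succ_4 by (intro mult_strict_left_mono) auto
    also have "\<dots> = (n 1)\<^sup>2 * (n 3)\<^sup>2"
      unfolding power_mult_distrib[symmetric] n4 ..
    finally show ?thesis
      using k[of 1] pos[of 3] unfolding a4_def b1_def by (simp add: field_simps)
  qed
  ultimately have "max a2 a4 < min b1 b3" by simp
  moreover have "0 \<le> max a2 a4"
    using k[of 2] by (simp add: a2_def le_max_iff_disj)
  ultimately obtain c where c: "max a2 a4 < c\<^sup>2" "c\<^sup>2 < min b1 b3" "c \<notin> B"
    using exists_square_between B(1) by blast
  then obtain u v where uv: "linkage n F u v" "u 2 = c"
    using B(2) by blast
  note l = link[OF uv(1)]
  have "(u 1)\<^sup>2 > 4 * k 1"
    using square_of_quotient[of c "u 1" "n 1" "k 1"] uv(2) l k c(2) by (simp add: b1_def)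
  moreover have "(u 3)\<^sup>2 > 4 * k 3"
    using square_of_quotient[of c "u 3" "n 2" "k 3"] uv(2) l k c(2) by (simp add: b3_def)
  moreover have "(u 4)\<^sup>2 > 4 * k 4"
  proof -
    have "n 2 = c * u 3" "n 3 = u 4 * u 3" using l uv(2) by auto
    then have "u 4 * n 2 = n 3 * c" by simp
    then have "(u 4)\<^sup>2 * (n 2)\<^sup>2 = (n 3)\<^sup>2 * c\<^sup>2"
      unfolding power_mult_distrib[symmetric] by simp
    moreover have "(n 2)\<^sup>2 * (4 * k 4) < (n 3)\<^sup>2 * c\<^sup>2"
      using c(1) pos[of 3] by (simp add: a4_def field_simps)
    ultimately have "(n 2)\<^sup>2 * (4 * k 4) < (n 2)\<^sup>2 * (u 4)\<^sup>2"
      by (simp add: mult.commute)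
    then show ?thesis using pos[of 2] by simp
  qed
  moreover have "(u 2)\<^sup>2 > 4 * k 2"
    using c(1) uv(2) by (simp add: a2_def)
  ultimately have "\<forall>i. admissible (k i) (u i)"
    by (simp add: forall_4 admissible_def)
  then show ?thesis using uv(1) by (auto simp: realizable_def)
qed

lemma realizableI:
  assumes feas: "feasible n F k"
    and ov2: "k 1 > 0 \<Longrightarrow> k 2 < 0 \<Longrightarrow> k 3 > 0 \<Longrightarrow> k 4 < 0 \<Longrightarrow>
      arcs_overlap (half_window (n 1) (k 1)) (half_window (n 2) (k 3)) (F 2)"
    and ov3: "k 1 < 0 \<Longrightarrow> k 2 > 0 \<Longrightarrow> k 3 < 0 \<Longrightarrow> k 4 > 0 \<Longrightarrow>
      arcs_overlap (half_window (n 2) (k 2)) (half_window (n 3) (k 4)) (F 3)"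
  shows "realizable n F k"
proof -
  note feas1 = feasible_rotate[OF feas]
  note feas2 = feasible_rotate[OF feas1]
  note feas3 = feasible_rotate[OF feas2]
  have neg: "\<forall>i. F i \<noteq> 0 \<longrightarrow> k i < 0" if "feasible n F k" for n F k
    using that by (simp add: feasible_def)
  note rotate = realizable_rotate[OF _ neg]
  have k: "k i \<noteq> 0" for i
    using feas by (simp add: feasible_def)
  \<comment> \<open>The cases locate an edge with negative coefficient, which rotation brings to
    place 4. If it is edge 2 or 3, the opposite edge has a positive coefficient and no overlap is
    required.\<close>
  consider "k 4 < 0" | "k 4 > 0" "k 1 < 0" | "k 4 > 0" "k 1 > 0" "k 2 < 0"
    | "k 4 > 0" "k 1 > 0" "k 2 > 0" "k 3 < 0" | "k 4 > 0" "k 1 > 0" "k 2 > 0" "k 3 > 0"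
    using k[of 1] k[of 2] k[of 3] k[of 4] by linarith
  then show ?thesis
  proof cases
    case 1
    then show ?thesis using feas ov2 by (intro realizable_negative)
  next
    case 2
    have "realizable (\<lambda>i. n (i + 1)) (\<lambda>i. - F (i + 1)) (\<lambda>i. k (i + 1))"
      by (rule realizable_negative[OF feas1]; unfold succ_4 arcs_overlap_uminus)
        (use 2 ov3 in blast)+
    then show ?thesis by (rule rotate[OF _ feas])
  next
    case 3
    have "realizable (\<lambda>i. n (i + 1 + 1)) (\<lambda>i. - (- F (i + 1 + 1))) (\<lambda>i. k (i + 1 + 1))"
      by (rule realizable_negative[OF feas2]; unfold succ_4)
        (use 3 in linarith)+
    then show ?thesis by (intro rotate[OF _ feas] rotate[OF _ feas1])
  next
    case 4
    have "realizable (\<lambda>i. n (i + 1 + 1 + 1)) (\<lambda>i. - (- (- F (i + 1 + 1 + 1)))) (\<lambda>i. k (i + 1 + 1 + 1))"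
      by (rule realizable_negative[OF feas3]; unfold succ_4)
        (use 4 in linarith)+
    then show ?thesis by (intro rotate[OF _ feas] rotate[OF _ feas1] rotate[OF _ feas2])
  next
    case 5
    then show ?thesis using feas by (intro realizable_all_positive) (auto simp: forall_4)
  qed
qed

section \<open>From a strictly admissible point to a motion\<close>

lemma moebius_shift_turn:
  assumes "x\<^sup>2 + k = u * x" "x \<noteq> 0" "turn F u v" "F \<noteq> 0 \<longrightarrow> k = -1"
  obtains y where "moebius_shift F (Some x) = Some y" "y\<^sup>2 + k = v * y"
proof (cases "F = 0")
  case True
  then show thesis using that[of x] assms by (simp add: moebius_shift_def)
next
  case False
  with assms have k: "k = -1" by simp
  define D where "D = 1 - F\<^sup>2 - F * u"
  have D: "D \<noteq> 0" "v * D = (1 - F\<^sup>2) * u + 4 * F"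
    using assms(3) turn_denominator_nonzero[of F u v] by (simp_all add: D_def turn_iff)
  have x: "x\<^sup>2 = u * x + 1" using assms(1) k by simp
  \<comment> \<open>By the quadratic equation for \<open>x\<close>, a nonzero \<open>D\<close>
    prevents \<open>x\<close> from being the pole of the shift.\<close>
  have prod: "(x + F) * (1 - F * x) = x * D"
    using x unfolding D_def by algebra
  then have nz: "1 - F * x \<noteq> 0" using assms(2) D(1) by auto
  define y where "y = (x + F) / (1 - F * x)"
  have y: "y * (1 - F * x) = x + F" using nz by (simp add: y_def)
  have "(y\<^sup>2 - 1) * (1 - F * x)\<^sup>2 = (x + F)\<^sup>2 - (1 - F * x)\<^sup>2"
    using y by algebra
  also have "\<dots> = x * ((1 - F\<^sup>2) * u + 4 * F)"
    using x by algebra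
  also have "\<dots> = v * y * (1 - F * x)\<^sup>2"
    using prod y D(2) by algebra
  finally have "y\<^sup>2 + k = v * y"
    using nz k by simp
  moreover have "moebius_shift F (Some x) = Some y"
    using nz by (simp add: moebius_shift_def y_def)
  ultimately show thesis using that by blast
qed

lemma quad_eq_Some:
  assumes "p\<^sup>2 + l = u * p" "r\<^sup>2 + m = w * r" "u * w = n"
  shows "quad_eq l m n (Some p) (Some r)"
  using assms by (auto simp: quad_eq_def hom_coords_def)

text \<open>A fixed sign of the square root gives a branch that is continuous in
  \<open>u\<close>.\<close>

definition larger_root :: "real \<Rightarrow> real \<Rightarrow> real" where
  "larger_root k u = (u + sqrt (u\<^sup>2 - 4 * k)) / 2"

lemma larger_root:
  assumes "admissible k u" "k \<noteq> 0"
  shows "(larger_root k u)\<^sup>2 + k = u * larger_root k u" "larger_root k u \<noteq> 0"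
proof -
  have "u\<^sup>2 - 4 * k \<ge> 0"
    using assms(1) by (auto simp: admissible_def intro: order_trans[of _ 0])
  then have "(sqrt (u\<^sup>2 - 4 * k))\<^sup>2 = u\<^sup>2 - 4 * k" by simp
  moreover have "2 * larger_root k u = u + sqrt (u\<^sup>2 - 4 * k)"
    by (simp add: larger_root_def)
  ultimately show "(larger_root k u)\<^sup>2 + k = u * larger_root k u"
    by algebra
  then show "larger_root k u \<noteq> 0" using assms(2) by auto
qed

text \<open>Condition (b) leaves one coefficient per edge: even edges carry the
  \<open>\<lambda>\<close> of their two quadrilaterals, odd edges the \<open>\<mu>\<close>.\<close>

locale OI_mesh =
  fixes M :: mesh and n F k :: "4 \<Rightarrow> real"
  assumes n_def: "n = m_nu M" and F_def: "F = m_F M"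
    and k_lambda: "m_lambda M 1 = k 2" "m_lambda M 2 = k 2" "m_lambda M 3 = k 4" "m_lambda M 4 = k 4"
    and k_mu: "m_mu M 1 = k 1" "m_mu M 2 = k 3" "m_mu M 3 = k 3" "m_mu M 4 = k 1"
    and n_nz: "n i \<noteq> 0" and k_nz: "k i \<noteq> 0" and F_k: "F i \<noteq> 0 \<longrightarrow> k i = -1"
    and minors: "minors_vanish (oi_proj_row1 (n 1) (n 2) (F 2) (F 3)) (oi_proj_row2 (n 3) (n 4) (F 1) (F 4))"
begin

lemma configuration_iff:
  "configuration M x \<longleftrightarrow>
    quad_eq (k 2) (k 1) (n 1) (x 2) (x 1) \<and>
    quad_eq (k 2) (k 3) (n 2) (moebius_shift (F 2) (x 2)) (moebius_shift (F 3) (x 3)) \<and>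
    quad_eq (k 4) (k 3) (n 3) (x 4) (x 3) \<and>
    quad_eq (k 4) (k 1) (n 4) (moebius_shift (F 4) (x 4)) (moebius_shift (F 1) (x 1))"
  by (simp only: configuration_def Let_def k_lambda k_mu n_def F_def)

lemma configuration_larger_root:
  assumes "linkage n F u v" "\<forall>i. admissible (k i) (u i)"
  shows "configuration M (\<lambda>i. Some (larger_root (k i) (u i)))"
proof -
  define x where "x = (\<lambda>i. larger_root (k i) (u i))"
  have x: "(x i)\<^sup>2 + k i = u i * x i" "x i \<noteq> 0" for i
    using larger_root[of "k i" "u i"] assms(2) k_nz by (simp_all add: x_def)
  have "\<forall>i. \<exists>y. moebius_shift (F i) (Some (x i)) = Some y \<and> y\<^sup>2 + k i = v i * y"
    using x F_k assms(1) moebius_shift_turn unfolding linkage_def by metis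
  then obtain y where y: "\<And>i. moebius_shift (F i) (Some (x i)) = Some (y i)" "\<And>i. (y i)\<^sup>2 + k i = v i * y i"
    by metis
  have "configuration M (\<lambda>i. Some (x i))"
    unfolding configuration_iff y(1)
    using assms(1) x(1) y(2) by (auto simp: linkage_def intro: quad_eq_Some)
  then show ?thesis by (simp only: x_def)
qed

lemma flexible_if_curve:
  fixes u v :: "real \<Rightarrow> 4 \<Rightarrow> real"
  assumes link: "\<And>s. s \<in> {0..1} \<Longrightarrow> linkage n F (u s) (v s)"
    and adm: "\<And>s i. s \<in> {0..1} \<Longrightarrow> admissible (k i) (u s i)"
    and cont: "\<And>i. continuous_on {0..1} (\<lambda>s. u s i)"
    and inj: "inj_on (\<lambda>s. u s j) {0..1}"
  shows "flexible M"
  unfolding flexible_def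
proof (intro exI conjI ballI)
  let ?x = "\<lambda>s i. larger_root (k i) (u s i)"
  let ?g = "\<lambda>s i. Some (?x s i)"
  have "continuous_on {0..1} (\<lambda>s. ?x s i)" for i
    unfolding larger_root_def by (intro continuous_intros cont) simp
  then have "continuous_map (subtopology euclideanreal {0..1}) euclideanreal (\<lambda>s. ?x s i)" for i
    by simp
  from continuous_map_compose[OF this continuous_map_Some]
  show "pathin (product_topology (\<lambda>_. rp1_top) UNIV) ?g"
    by (simp add: pathin_def continuous_map_componentwise_UNIV rp1_top_def comp_def)
  show "inj_on ?g {0..1}"
  proof (rule inj_onI)
    fix s t assume st: "s \<in> {0..1}" "t \<in> {0..1}" "?g s = ?g t"
    then have eq: "?x s j = ?x t j" by (metis option.inject)
    \<comment> \<open>The root determines \<open>u\<close>, as \<open>u = x + k / x\<close>, so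
      injectivity is inherited.\<close>
    have "u s j * ?x s j = u t j * ?x t j"
      using larger_root(1)[OF adm[OF st(1)] k_nz] larger_root(1)[OF adm[OF st(2)] k_nz] eq by metis
    then have "u s j = u t j"
      using eq larger_root(2)[OF adm[OF st(2)] k_nz] by simp
    then show "s = t" using inj st by (auto dest: inj_onD)
  qed
  fix s :: real assume "s \<in> {0..1}"
  then show "configuration M (?g s)"
    using link adm by (intro configuration_larger_root) auto
qed

end

section \<open>Moving a strict solution along a curve\<close>

definition turned :: "real \<Rightarrow> real \<Rightarrow> real" where
  "turned F u = ((1 - F\<^sup>2) * u + 4 * F) / (1 - F\<^sup>2 - F * u)"

lemma turn_turned: "1 - F\<^sup>2 - F * u \<noteq> 0 \<Longrightarrow> turn F u (turned F u)"
  by (simp add: turn_iff turned_def)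

lemma turned_eq: "turn F u v \<Longrightarrow> turned F u = v"
  using turn_unique turn_turned turn_denominator_nonzero by blast

lemma isCont_turned:
  assumes "isCont f w" "1 - F\<^sup>2 - F * f w \<noteq> 0"
  shows "isCont (\<lambda>w. turned F (f w)) w"
  unfolding turned_def using assms by (intro continuous_intros) auto

lemma continuous_on_turned:
  assumes "continuous_on S f" "\<And>w. w \<in> S \<Longrightarrow> 1 - F\<^sup>2 - F * f w \<noteq> 0"
  shows "continuous_on S (\<lambda>w. turned F (f w))"
  unfolding turned_def using assms by (intro continuous_intros) auto

lemma isCont_eventually_nonzero:
  fixes f :: "real \<Rightarrow> real"
  assumes "isCont f w" "f w \<noteq> 0"
  shows "\<forall>\<^sub>F w in nhds w. f w \<noteq> 0"
  using tendsto_imp_eventually_ne[of f "f w" "nhds w" 0] assms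
  by (simp add: isCont_def tendsto_at_iff_tendsto_nhds)

lemma isCont_eventually_admissible:
  assumes "isCont f w" "admissible k (f w)"
  shows "\<forall>\<^sub>F w in nhds w. admissible k (f w)"
proof (cases "k < 0")
  case False
  have "((\<lambda>w. (f w)\<^sup>2) \<longlongrightarrow> (f w)\<^sup>2) (nhds w)"
    using assms(1) by (intro tendsto_power) (simp add: isCont_def tendsto_at_iff_tendsto_nhds)
  then have "\<forall>\<^sub>F w in nhds w. (f w)\<^sup>2 > 4 * k"
    using assms(2) False by (intro order_tendstoD(1)) (auto simp: admissible_def)
  then show ?thesis by (rule eventually_mono) (simp add: admissible_def)
qed (simp add: admissible_def)

text \<open>The value of \<open>u 2\<close> is varied near a strict solution: nonzero denominators
  and strict inequalities persist, and \<open>turn_closes\<close> keeps the cycle closed.\<close>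

lemma (in OI_mesh) flexible_if_realizable:
  assumes "realizable n F k"
  shows "flexible M"
proof -
  obtain a b where ab: "linkage n F a b" "\<And>i. admissible (k i) (a i)"
    using assms by (auto simp: realizable_def)
  define c where "c = a 2"
  note link = ab(1)[unfolded linkage_def, folded c_def]
  \<comment> \<open>The \<open>f\<close> and \<open>g\<close> with index \<open>i\<close> express
    \<open>u i\<close> and \<open>v i\<close> through \<open>w = u 2\<close>. Edge 3 is traversed
    from \<open>v\<close> to \<open>u\<close>, hence the \<open>- F 3\<close>.\<close>
  define g2 where "g2 w = turned (F 2) w" for w
  define g3 where "g3 w = n 2 / g2 w" for w
  define f3 where "f3 w = turned (- F 3) (g3 w)" for w
  define f4 where "f4 w = n 3 / f3 w" for w
  define g4 where "g4 w = turned (F 4) (f4 w)" for w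
  define f1 where "f1 w = n 1 / w" for w
  define g1 where "g1 w = n 4 / g4 w" for w
  have turns: "turn (F 2) c (b 2)" "turn (- F 3) (b 3) (a 3)" "turn (F 4) (a 4) (b 4)"
    using link by (auto simp: turn_commute c_def)
  have nz: "c \<noteq> 0" "b 2 \<noteq> 0" "a 3 \<noteq> 0" "b 4 \<noteq> 0"
    using link n_nz by (metis mult_zero_left mult_zero_right)+
  have g2: "g2 c = b 2" using turns by (simp add: g2_def turned_eq)
  have g3: "g3 c = b 3" using link nz g2 by (simp add: g3_def field_simps)
  have f3: "f3 c = a 3" using turns g3 by (simp add: f3_def turned_eq)
  have f4: "f4 c = a 4" using link nz f3 by (simp add: f4_def field_simps)
  have g4: "g4 c = b 4" using turns f4 by (simp add: g4_def turned_eq)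
  have f1: "f1 c = a 1" using link nz by (simp add: f1_def field_simps)
  define d2 where "d2 w = 1 - (F 2)\<^sup>2 - F 2 * w" for w
  define d3 where "d3 w = 1 - (- F 3)\<^sup>2 - (- F 3) * g3 w" for w
  define d4 where "d4 w = 1 - (F 4)\<^sup>2 - F 4 * f4 w" for w
  have d: "d2 c \<noteq> 0" "d3 c \<noteq> 0" "d4 c \<noteq> 0"
    using turns[THEN turn_denominator_nonzero] by (simp_all add: d2_def d3_def d4_def g3 f4)
  have cont: "isCont d2 c" "isCont g2 c" "isCont g3 c" "isCont d3 c" "isCont f3 c" "isCont f4 c"
    "isCont d4 c" "isCont g4 c" "isCont f1 c"
  proof -
    show "isCont d2 c" unfolding d2_def by (intro continuous_intros)
    show "isCont g2 c" unfolding g2_def using d by (intro isCont_turned continuous_intros) (simp add: d2_def)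
    then show "isCont g3 c" unfolding g3_def using nz g2 by (intro continuous_intros) auto
    then show "isCont d3 c" unfolding d3_def by (intro continuous_intros)
    show "isCont f3 c" unfolding f3_def using d \<open>isCont g3 c\<close> by (intro isCont_turned) (simp_all add: d3_def)
    then show "isCont f4 c" unfolding f4_def using nz f3 by (intro continuous_intros) auto
    then show "isCont d4 c" unfolding d4_def by (intro continuous_intros)
    show "isCont g4 c" unfolding g4_def using d \<open>isCont f4 c\<close> by (intro isCont_turned) (simp_all add: d4_def)
    show "isCont f1 c" unfolding f1_def using nz by (intro continuous_intros) auto
  qed
  define good where "good w \<longleftrightarrow> w \<noteq> 0 \<and> d2 w \<noteq> 0 \<and> g2 w \<noteq> 0 \<and> d3 w \<noteq> 0 \<and> f3 w \<noteq> 0 \<and> d4 w \<noteq> 0 \<and> g4 w \<noteq> 0 \<and>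
    admissible (k 1) (f1 w) \<and> admissible (k 2) w \<and> admissible (k 3) (f3 w) \<and> admissible (k 4) (f4 w)" for w
  have "admissible (k 2) c"
    using ab(2) by (simp add: c_def)
  then have "\<forall>\<^sub>F w in nhds c. good w"
    unfolding good_def using d nz g2 f3 g4 ab(2)[of 1] ab(2)[of 3] ab(2)[of 4]
    by (intro eventually_conj isCont_eventually_nonzero isCont_eventually_admissible cont)
      (simp_all add: f1 f3 f4)
  then obtain e where e: "e > 0" "\<And>w. dist w c < e \<Longrightarrow> good w"
    unfolding eventually_nhds_metric by blast
  define h where "h s = c + s * (e / 2)" for s :: real
  have good: "good (h s)" if "s \<in> {0..1}" for s
  proof -
    have "s * (e / 2) \<le> 1 * (e / 2)" using that e(1) by (intro mult_right_mono) auto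
    then show ?thesis using that e(1) by (intro e(2)) (simp add: h_def dist_real_def abs_mult)
  qed
  have h: "continuous_on {0..1} h" unfolding h_def by (intro continuous_intros)
  have "continuous_on {0..1} (\<lambda>s. g2 (h s))"
    unfolding g2_def using good by (intro continuous_on_turned h) (auto simp: good_def d2_def)
  then have ch: "continuous_on {0..1} (\<lambda>s. g3 (h s))"
    unfolding g3_def using good by (intro continuous_intros) (auto simp: good_def)
  have c3: "continuous_on {0..1} (\<lambda>s. f3 (h s))"
    unfolding f3_def using good by (intro continuous_on_turned ch) (auto simp: good_def d3_def)
  then have c4: "continuous_on {0..1} (\<lambda>s. f4 (h s))"
    unfolding f4_def using good by (intro continuous_intros) (auto simp: good_def)
  have c1: "continuous_on {0..1} (\<lambda>s. f1 (h s))"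
    unfolding f1_def using good by (intro continuous_intros h) (auto simp: good_def)
  define u where "u s i = (if i = 1 then f1 (h s) else if i = 2 then h s else if i = 3 then f3 (h s) else f4 (h s))"
    for s and i :: 4
  define v where "v s i = (if i = 1 then g1 (h s) else if i = 2 then g2 (h s) else if i = 3 then g3 (h s) else g4 (h s))"
    for s and i :: 4
  have u: "u s 1 = f1 (h s)" "u s 2 = h s" "u s 3 = f3 (h s)" "u s 4 = f4 (h s)"
    and v: "v s 1 = g1 (h s)" "v s 2 = g2 (h s)" "v s 3 = g3 (h s)" "v s 4 = g4 (h s)" for s
    by (simp_all add: u_def v_def)
  show ?thesis
  proof (rule flexible_if_curve)
    fix s :: real assume s: "s \<in> {0..1}"
    note G = good[OF s, unfolded good_def]
    have prods: "h s * f1 (h s) = n 1" "g2 (h s) * g3 (h s) = n 2" "f4 (h s) * f3 (h s) = n 3" "g4 (h s) * g1 (h s) = n 4"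
      using G by (simp_all add: f1_def g3_def f4_def g1_def)
    have t2: "turn (F 2) (h s) (g2 (h s))"
      using G by (auto simp: g2_def d2_def intro: turn_turned)
    have "turn (- F 3) (g3 (h s)) (f3 (h s))"
      using G unfolding f3_def d3_def by (intro turn_turned) auto
    then have t3: "turn (F 3) (f3 (h s)) (g3 (h s))"
      by (simp add: turn_commute)
    have t4: "turn (F 4) (f4 (h s)) (g4 (h s))"
      using G by (auto simp: g4_def d4_def intro: turn_turned)
    have t1: "turn (F 1) (f1 (h s)) (g1 (h s))"
      using turn_closes[OF minors n_nz n_nz n_nz n_nz] prods t2 t3 t4 by blast
    show "linkage n F (u s) (v s)"
      using prods t1 t2 t3 t4 unfolding linkage_def forall_4 u v by blast
    have "\<forall>i. admissible (k i) (u s i)"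
      using G unfolding forall_4 u by blast
    then show "admissible (k i) (u s i)" for i by blast
  next
    have "\<forall>i. continuous_on {0..1} (\<lambda>s. u s i)"
      using c1 h c3 c4 unfolding forall_4 u by blast
    then show "continuous_on {0..1} (\<lambda>s. u s i)" for i by blast
    show "inj_on (\<lambda>s. u s 2) {0..1}"
      using e(1) by (auto simp: u h_def inj_on_def)
  qed
qed

section \<open>Necessity of the overlap conditions\<close>

lemma moebius_shift_uminus: "moebius_shift (- F) (moebius_shift F x) = x"
proof (cases x)
  case None
  then show ?thesis by (simp add: moebius_shift_def)
next
  case (Some r)
  show ?thesis
  proof (cases "1 - F * r = 0")
    case True
    then have "F \<noteq> 0" by auto
    with True have "r = 1 / F" by (simp add: eq_divide_eq mult.commute)
    then show ?thesis using Some \<open>F \<noteq> 0\<close> by (simp add: moebius_shift_def)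
  next
    case False
    define y where "y = (r + F) / (1 - F * r)"
    have F2: "1 + F\<^sup>2 \<noteq> 0" by (smt (verit) zero_le_power2)
    have y: "y * (1 - F * r) = r + F" using False by (simp add: y_def)
    have z: "(1 + F * y) * (1 - F * r) = 1 + F\<^sup>2"
      using y by algebra
    then have "(y - F) * (1 - F * r) = r * (1 + F * y) * (1 - F * r)"
      using y by algebra
    then have "y - F = r * (1 + F * y)"
      using False by simp
    moreover have "1 + F * y \<noteq> 0"
      using z F2 by auto
    ultimately have "(y - F) / (1 + F * y) = r" "1 + F * y \<noteq> 0"
      by simp_all
    then show ?thesis using Some False by (simp add: moebius_shift_def flip: y_def)
  qed
qed

lemma inj_moebius_shift: "inj (moebius_shift F)"
  by (rule inj_on_inverseI[of _ "moebius_shift (- F)"]) (simp add: moebius_shift_uminus)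

lemma moebius_shift_0 [simp]: "moebius_shift 0 x = x"
  by (simp add: moebius_shift_def split: option.split)

section \<open>Finiteness of the fibres of the configuration space\<close>

lemma quad_eq_commute: "quad_eq l m n u w \<longleftrightarrow> quad_eq m l n w u"
  by (auto simp: quad_eq_def algebra_simps split: prod.split)

text \<open>For fixed \<open>w\<close> this is a polynomial equation in \<open>u\<close>. Its
  leading coefficient is \<open>m\<close> at \<open>w = 0\<close> and \<open>1\<close> at infinity;
  at other \<open>w\<close> the linear coefficient is nonzero. So it is never identically
  satisfied.\<close>

lemma finite_quad_eq:
  assumes "m \<noteq> 0" "n \<noteq> 0"
  shows "finite {u. quad_eq l m n u w}"
proof -
  have "\<exists>p. p \<noteq> 0 \<and> {u. quad_eq l m n u w} \<subseteq> insert None (Some ` {r. poly p r = 0})"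
  proof (cases w)
    case None
    have "{u. quad_eq l m n u w} \<subseteq> insert None (Some ` {r. poly [:l, 0, 1:] r = 0})"
    proof
      fix u assume "u \<in> {u. quad_eq l m n u w}"
      then show "u \<in> insert None (Some ` {r. poly [:l, 0, 1:] r = 0})"
        using None by (cases u) (auto simp: quad_eq_def hom_coords_def power2_eq_square)
    qed
    then show ?thesis by (intro exI[of _ "[:l, 0, 1:]"]) simp
  next
    case (Some s)
    let ?p = "[:l * (s\<^sup>2 + m), - n * s, s\<^sup>2 + m:]"
    have "?p \<noteq> 0" using assms by (cases "s = 0") auto
    moreover have "{u. quad_eq l m n u w} \<subseteq> insert None (Some ` {r. poly ?p r = 0})"
    proof
      fix u assume "u \<in> {u. quad_eq l m n u w}"
      then show "u \<in> insert None (Some ` {r. poly ?p r = 0})"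
        using Some by (cases u) (auto simp: quad_eq_def hom_coords_def power2_eq_square algebra_simps)
    qed
    ultimately show ?thesis by blast
  qed
  then show ?thesis
    using poly_roots_finite by (metis finite_imageI finite_insert finite_subset)
qed

lemma finite_quad_eq_partners:
  assumes "m \<noteq> 0" "n \<noteq> 0" "finite A"
  shows "finite {u. \<exists>w\<in>A. quad_eq l m n u w}"
proof -
  have "{u. \<exists>w\<in>A. quad_eq l m n u w} = (\<Union>w\<in>A. {u. quad_eq l m n u w})" by blast
  then show ?thesis using finite_quad_eq assms by simp
qed

context OI_mesh
begin

lemma finite_configurations_over_1:
  assumes "finite A"
  shows "finite {x. configuration M x \<and> x 1 \<in> A}"
proof -
  \<comment> \<open>From edge 1, the first and last quadrilaterals reach edges 2 and 4; the third
    leads on to edge 3.\<close>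
  define A2 where "A2 = {u. \<exists>w\<in>A. quad_eq (k 2) (k 1) (n 1) u w}"
  define A4 where "A4 = moebius_shift (F 4) -` {u. \<exists>w\<in>moebius_shift (F 1) ` A. quad_eq (k 4) (k 1) (n 4) u w}"
  define A3 where "A3 = {u. \<exists>w\<in>A4. quad_eq (k 3) (k 4) (n 3) u w}"
  have fin: "finite A2" "finite A4"
    unfolding A2_def A4_def
    by (intro finite_quad_eq_partners finite_vimageI inj_moebius_shift finite_imageI n_nz k_nz assms)+
  then have "finite A3"
    unfolding A3_def using n_nz k_nz by (intro finite_quad_eq_partners)
  define P where "P i = (if i = 1 then A else if i = 2 then A2 else if i = 3 then A3 else A4)" for i :: 4
  have P: "P 1 = A" "P 2 = A2" "P 3 = A3" "P 4 = A4"
    by (simp_all add: P_def)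
  have "\<forall>i. finite (P i)"
    unfolding forall_4 P using assms fin \<open>finite A3\<close> by blast
  then have "finite (Pi\<^sub>E UNIV P)"
    by (intro finite_PiE) auto
  moreover have "{x. configuration M x \<and> x 1 \<in> A} \<subseteq> Pi\<^sub>E UNIV P"
  proof
    fix x assume "x \<in> {x. configuration M x \<and> x 1 \<in> A}"
    then have "\<forall>i. x i \<in> P i"
      unfolding forall_4 P A2_def A3_def A4_def configuration_iff mem_Collect_eq vimage_eq
      using quad_eq_commute by blast
    then show "x \<in> Pi\<^sub>E UNIV P" by auto
  qed
  ultimately show ?thesis by (rule finite_subset[rotated])
qed

lemma finite_configurations_over:
  assumes "finite A"
  shows "finite {x. configuration M x \<and> x i \<in> A}"
proof -
  have two: "finite {x. configuration M x \<and> x 2 \<in> A}"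
    using finite_configurations_over_1[OF finite_quad_eq_partners[OF k_nz n_nz assms, of "k 1" 2 1]]
    by (rule rev_finite_subset) (auto simp: configuration_iff quad_eq_commute[of "k 2" "k 1"])
  have four: "finite {x. configuration M x \<and> x 4 \<in> A}" if "finite A" for A
  proof -
    have "finite (moebius_shift (F 1) -` {u. \<exists>w\<in>moebius_shift (F 4) ` A. quad_eq (k 1) (k 4) (n 4) u w})"
      using that n_nz k_nz by (intro finite_vimageI finite_quad_eq_partners inj_moebius_shift) auto
    from finite_configurations_over_1[OF this] show ?thesis
      by (rule rev_finite_subset) (auto simp: configuration_iff quad_eq_commute[of "k 4" "k 1"])
  qed
  have three: "finite {x. configuration M x \<and> x 3 \<in> A}"
    using four[OF finite_quad_eq_partners[OF k_nz n_nz assms, of "k 4" 3 3]]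
    by (rule rev_finite_subset) (auto simp: configuration_iff)
  have "\<forall>i. finite {x. configuration M x \<and> x i \<in> A}"
    unfolding forall_4 using finite_configurations_over_1[OF assms] two three four[OF assms] by blast
  then show ?thesis by blast
qed

text \<open>An injective curve has infinitely many points, of which only finitely many have a
  coordinate in a set \<open>B i\<close>.\<close>

lemma generic_configuration:
  assumes "flexible M" "\<And>i. finite (B i)"
  obtains x where "configuration M x" "\<And>i. x i \<notin> B i"
proof -
  obtain g where g: "inj_on g {0..1::real}" "\<forall>s\<in>{0..1}. configuration M (g s)"
    using assms(1) by (auto simp: flexible_def)
  have "infinite (g ` {0..1})"
    using g(1) by (simp add: finite_image_iff infinite_Icc)
  then have "infinite {x. configuration M x}"
    using g(2) finite_subset[of "g ` {0..1}" "{x. configuration M x}"] by blast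
  moreover have "finite (\<Union>i. {x. configuration M x \<and> x i \<in> B i})"
    using assms(2) by (intro finite_UN_I finite_configurations_over) auto
  ultimately have "\<not> {x. configuration M x} \<subseteq> (\<Union>i. {x. configuration M x \<and> x i \<in> B i})"
    using finite_subset by blast
  then show thesis using that by blast
qed

end

text \<open>
  At \<open>\<plusminus>sqrt k\<close> the variable \<open>x + k / x\<close> attains the boundary value \<open>\<plusminus>2 sqrt k\<close>; the remaining
  values make \<open>x + k / x\<close> or \<open>y + k / y\<close> infinite.
\<close>

definition exceptional_values :: "real \<Rightarrow> real \<Rightarrow> rp1 set" where
  "exceptional_values F k = {None, Some 0, Some (sqrt k), Some (- sqrt k)} \<union> moebius_shift F -` {None, Some 0}"

lemma finite_exceptional_values: "finite (exceptional_values F k)"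
  by (auto simp: exceptional_values_def intro!: finite_vimageI inj_moebius_shift)

text \<open>With \<open>a = Some \<alpha>\<close>, the square of the partner variable exceeds
  \<open>4 * k\<close> by \<open>((\<alpha>\<^sup>2 - k) / \<alpha>)\<^sup>2\<close>, which is
  positive off the exceptional values.\<close>

lemma quad_eq_window:
  assumes "quad_eq \<kappa> k n (Some r) a" "r \<noteq> 0" "k > 0" "n \<noteq> 0" "a \<notin> exceptional_values F k"
  shows "\<bar>(r\<^sup>2 + \<kappa>) / r\<bar> < 2 * half_window n k"
proof -
  obtain \<alpha> where \<alpha>: "a = Some \<alpha>" "\<alpha> \<noteq> 0" "\<alpha> \<noteq> sqrt k" "\<alpha> \<noteq> - sqrt k"
    using assms(5) by (cases a) (auto simp: exceptional_values_def)
  have "\<alpha>\<^sup>2 \<noteq> k"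
    using \<alpha>(3,4) by (auto simp: abs_if split: if_splits)
  then have "0 < ((\<alpha>\<^sup>2 - k) / \<alpha>)\<^sup>2"
    using \<alpha>(2) by simp
  also have "\<dots> = ((\<alpha>\<^sup>2 + k) / \<alpha>)\<^sup>2 - 4 * k"
    using \<alpha>(2) by (simp add: field_simps power2_eq_square)
  finally have "((\<alpha>\<^sup>2 + k) / \<alpha>)\<^sup>2 > 4 * k" by simp
  moreover have "(r\<^sup>2 + \<kappa>) / r * ((\<alpha>\<^sup>2 + k) / \<alpha>) = n"
    using assms(1,2) \<alpha>(1,2) by (simp add: quad_eq_def hom_coords_def field_simps)
  ultimately show ?thesis
    using half_window_iff assms(3,4) by blast
qed

lemma turn_of_moebius_shift:
  assumes "moebius_shift F (Some r) = Some y" "r \<noteq> 0" "y \<noteq> 0" "F \<noteq> 0 \<longrightarrow> \<kappa> = -1"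
  shows "turn F ((r\<^sup>2 + \<kappa>) / r) ((y\<^sup>2 + \<kappa>) / y)"
proof (cases "F = 0")
  case False
  then have \<kappa>: "\<kappa> = -1" using assms by simp
  have "1 - F * r \<noteq> 0" "y = (r + F) / (1 - F * r)"
    using assms(1) by (auto simp: moebius_shift_def split: if_splits)
  then have y: "y * (1 - F * r) = r + F" by simp
  define u v where "u = (r\<^sup>2 + \<kappa>) / r" and "v = (y\<^sup>2 + \<kappa>) / y"
  have uv: "u * r = r\<^sup>2 - 1" "v * y = y\<^sup>2 - 1"
    using assms \<kappa> by (simp_all add: u_def v_def)
  have "((1 - F\<^sup>2) * (v - u)) * (r * y) = (F * (4 + u * v)) * (r * y)"
    using uv y by algebra
  then have "(1 - F\<^sup>2) * (v - u) = F * (4 + u * v)"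
    using assms(2,3) by simp
  then show ?thesis
    by (simp add: turn_def u_def v_def)
qed (use assms in auto)

lemma arcs_overlap_of_quad_eqs:
  assumes "quad_eq \<kappa> k n x a" "quad_eq \<kappa> k' n' (moebius_shift F x) b"
    and "F \<noteq> 0 \<longrightarrow> \<kappa> = -1" "k > 0" "k' > 0" "n \<noteq> 0" "n' \<noteq> 0"
    and "x \<notin> exceptional_values F \<kappa>" "a \<notin> exceptional_values G k" "b \<notin> exceptional_values G' k'"
  shows "arcs_overlap (half_window n k) (half_window n' k') F"
proof -
  obtain r where r: "x = Some r" "r \<noteq> 0"
    using assms(8) by (cases x) (auto simp: exceptional_values_def)
  obtain y where y: "moebius_shift F x = Some y" "y \<noteq> 0"
    using assms(8) by (cases "moebius_shift F x") (auto simp: exceptional_values_def)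
  have "turn F ((r\<^sup>2 + \<kappa>) / r) ((y\<^sup>2 + \<kappa>) / y)"
    using turn_of_moebius_shift r y assms(3) by blast
  moreover have "\<bar>(r\<^sup>2 + \<kappa>) / r\<bar> < 2 * half_window n k"
    using quad_eq_window r assms by blast
  moreover have "\<bar>(y\<^sup>2 + \<kappa>) / y\<bar> < 2 * half_window n' k'"
    using quad_eq_window y assms by metis
  ultimately show ?thesis
    using arcs_overlap_iff half_window_pos assms by blast
qed

lemma (in OI_mesh) flexible_iff:
  assumes adj: "\<And>i. k i > 0 \<Longrightarrow> k (i + 1) > 0 \<Longrightarrow> 16 * k i * k (i + 1) < (n i)\<^sup>2"
  shows "flexible M \<longleftrightarrow>
    (k 1 > 0 \<and> k 2 < 0 \<and> k 3 > 0 \<and> k 4 < 0 \<longrightarrow>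
      arcs_overlap (half_window (n 1) (k 1)) (half_window (n 2) (k 3)) (F 2)) \<and>
    (k 1 < 0 \<and> k 2 > 0 \<and> k 3 < 0 \<and> k 4 > 0 \<longrightarrow>
      arcs_overlap (half_window (n 2) (k 2)) (half_window (n 3) (k 4)) (F 3))"
    (is "_ \<longleftrightarrow> ?ov2 \<and> ?ov3")
proof
  assume "flexible M"
  from generic_configuration[OF this, of "\<lambda>i. exceptional_values (F i) (k i)", OF finite_exceptional_values]
  obtain x where x: "configuration M x" "\<And>i. x i \<notin> exceptional_values (F i) (k i)"
    by blast
  note eqs = x(1)[unfolded configuration_iff]
  \<comment> \<open>Edges with positive coefficient are not shifted, so \<open>y = x\<close>
    there.\<close>
  have F: "k i > 0 \<Longrightarrow> F i = 0" for i
    using F_k[of i] by auto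
  show "?ov2 \<and> ?ov3"
  proof (intro conjI impI)
    assume k: "k 1 > 0 \<and> k 2 < 0 \<and> k 3 > 0 \<and> k 4 < 0"
    then have "quad_eq (k 2) (k 3) (n 2) (moebius_shift (F 2) (x 2)) (x 3)"
      using eqs F[of 3] by simp
    with eqs k x(2) F_k n_nz show "arcs_overlap (half_window (n 1) (k 1)) (half_window (n 2) (k 3)) (F 2)"
      by (intro arcs_overlap_of_quad_eqs[of "k 2" _ _ "x 2" "x 1" _ _ _ "x 3" "F 1" "F 3"]) blast+
  next
    assume k: "k 1 < 0 \<and> k 2 > 0 \<and> k 3 < 0 \<and> k 4 > 0"
    then have "quad_eq (k 3) (k 2) (n 2) (moebius_shift (F 3) (x 3)) (x 2)"
      using eqs F[of 2] by (simp add: quad_eq_commute[of "k 3"])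
    moreover have "quad_eq (k 3) (k 4) (n 3) (x 3) (x 4)"
      using eqs by (simp add: quad_eq_commute[of "k 3"])
    ultimately have "arcs_overlap (half_window (n 3) (k 4)) (half_window (n 2) (k 2)) (F 3)"
      using x(2) F_k n_nz k
      by (intro arcs_overlap_of_quad_eqs[of "k 3" _ _ "x 3" "x 4" _ _ _ "x 2" "F 4" "F 2"]) blast+
    then show "arcs_overlap (half_window (n 2) (k 2)) (half_window (n 3) (k 4)) (F 3)"
      by (subst arcs_overlap_commute)
  qed
next
  assume ov: "?ov2 \<and> ?ov3"
  have "generically_movable n F"
    using generically_movable_if_minors_vanish[OF minors] n_nz by blast
  then have "feasible n F k"
    unfolding feasible_def using n_nz k_nz F_k adj by fastforce
  then have "realizable n F k"
    using ov by (intro realizableI) blast+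
  then show "flexible M"
    by (rule flexible_if_realizable)
qed

lemma arcs_overlap_iff_half_angle:
  assumes "k > 0" "k' > 0"
  shows "arcs_overlap (half_window n k) (half_window n' k') (m_F M i) \<longleftrightarrow>
    (case m_t M i of
       None \<Rightarrow> 16 * sqrt (k * k') - \<bar>n * n'\<bar> < 0
     | Some t \<Rightarrow> t = 0 \<or> 16 * sqrt (k * k') - \<bar>n * n'\<bar> < (4 * \<bar>n'\<bar> * sqrt k + 4 * \<bar>n\<bar> * sqrt k') / \<bar>t\<bar>)"
proof -
  define F where "F = m_F M i"
  define q where "q = 1 - F\<^sup>2"
  \<comment> \<open>This factor clears the denominators of both windows and turns their product into
    \<open>\<bar>n * n'\<bar>\<close>.\<close>
  define P where "P = 16 * sqrt (k * k')"
  define X where "X = P - \<bar>n * n'\<bar>"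
  define Y where "Y = 4 * \<bar>n'\<bar> * sqrt k + 4 * \<bar>n\<bar> * sqrt k'"
  have P: "P > 0" using assms by (simp add: P_def)
  have "P * (1 - half_window n k * half_window n' k') = X"
    using assms by (simp add: P_def X_def half_window_def real_sqrt_mult abs_mult field_simps)
  moreover have "P * (half_window n k + half_window n' k') = Y"
    using assms by (simp add: P_def Y_def half_window_def real_sqrt_mult field_simps)
  moreover have "arcs_overlap (half_window n k) (half_window n' k') F \<longleftrightarrow>
      F = 0 \<or> P * (2 * \<bar>F\<bar> * (1 - half_window n k * half_window n' k')) < P * (\<bar>q\<bar> * (half_window n k + half_window n' k'))"
    using P unfolding arcs_overlap_def q_def by (simp only: mult_less_cancel_left_pos)
  ultimately have ov: "arcs_overlap (half_window n k) (half_window n' k') F \<longleftrightarrow> F = 0 \<or> 2 * \<bar>F\<bar> * X < \<bar>q\<bar> * Y"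
    by (simp only: mult.left_commute[of P "2 * \<bar>F\<bar>"] mult.left_commute[of P "\<bar>q\<bar>"])
  show ?thesis
  proof (cases "q = 0")
    case True
    then have "F \<noteq> 0" "m_t M i = None" by (auto simp: q_def m_t_def F_def)
    then show ?thesis
      using ov True by (simp add: F_def[symmetric] P_def[symmetric] X_def[symmetric] mult_less_0_iff)
  next
    case False
    then have t: "m_t M i = Some (2 * F / q)" by (simp add: q_def m_t_def F_def)
    have "2 * \<bar>F\<bar> * X < \<bar>q\<bar> * Y \<longleftrightarrow> X < Y / \<bar>2 * F / q\<bar>" if "F \<noteq> 0"
      using that False by (simp add: abs_mult field_simps)
    then show ?thesis
      using ov False unfolding t F_def[symmetric] P_def[symmetric] X_def[symmetric] Y_def[symmetric] by auto
  qed
qed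

section \<open>The parameters of an elliptic quadrilateral do not vanish\<close>

lemma cos_eq_0_iff_pi_half:
  assumes "x \<in> {0<..<pi}"
  shows "cos x = 0 \<longleftrightarrow> x = pi / 2"
proof
  assume "cos x = 0"
  then show "x = pi / 2"
    using cos_inj_pi[of x "pi / 2"] assms by auto
qed (simp only: cos_pi_half)

lemma cos_eq_uminus_cos_iff:
  assumes "x \<in> {0<..<pi}" "y \<in> {0<..<pi}"
  shows "cos x = - cos y \<longleftrightarrow> x + y = pi"
proof
  assume "cos x = - cos y"
  then have "cos x = cos (pi - y)" by simp
  then show "x + y = pi" using cos_inj_pi[of x "pi - y"] assms by auto
next
  assume "x + y = pi"
  then have "x = pi - y" by simp
  then show "cos x = - cos y" by simp
qed

lemma tan_nonzero: "x \<in> {0<..<pi} \<Longrightarrow> x \<noteq> pi / 2 \<Longrightarrow> tan x \<noteq> 0"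
  using sin_gt_zero[of x] cos_eq_0_iff_pi_half[of x] by (auto simp: tan_def)

lemma tan_eq_tan_iff:
  assumes "x \<in> {0<..<pi}" "y \<in> {0<..<pi}" "x \<noteq> pi / 2" "y \<noteq> pi / 2"
  shows "tan x = tan y \<longleftrightarrow> x = y"
proof
  assume "tan x = tan y"
  then have "sin (x - y) = 0"
    using assms by (simp add: tan_def sin_diff cos_eq_0_iff_pi_half field_simps)
  then show "x = y"
    using sin_gt_zero[of "x - y"] sin_gt_zero[of "y - x"] sin_minus[of "x - y"] assms
    by (cases x y rule: linorder_cases) auto
qed simp

lemma tan_eq_uminus_tan_iff:
  assumes "x \<in> {0<..<pi}" "y \<in> {0<..<pi}" "x \<noteq> pi / 2" "y \<noteq> pi / 2"
  shows "tan x = - tan y \<longleftrightarrow> x + y = pi"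
proof -
  have "tan x = - tan y \<longleftrightarrow> tan x = tan (pi - y)"
    by (simp add: tan_def sin_diff cos_diff)
  also have "\<dots> \<longleftrightarrow> x = pi - y"
    using assms by (intro tan_eq_tan_iff) auto
  finally show ?thesis by auto
qed

text \<open>The three exclusions are stable under exchanging \<open>\<alpha>\<close> and
  \<open>\<gamma>\<close>, which turns \<open>\<lambda>\<close> into \<open>\<mu>\<close>; results
  on \<open>\<mu>\<close> thus follow from those on \<open>\<lambda>\<close>.\<close>

locale od_quadrilateral =
  fixes \<alpha> \<beta> \<gamma> \<delta> :: real
  assumes angles: "\<alpha> \<in> {0<..<pi}" "\<beta> \<in> {0<..<pi}" "\<gamma> \<in> {0<..<pi}" "\<delta> \<in> {0<..<pi}"
    and od: "cos \<alpha> * cos \<gamma> = cos \<beta> * cos \<delta>"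
    and nondegenerate: "\<alpha> + \<beta> \<noteq> \<gamma> + \<delta>" "\<alpha> + \<delta> \<noteq> \<beta> + \<gamma>" "\<alpha> + \<beta> + \<gamma> + \<delta> \<noteq> 2 * pi"
begin

text \<open>Away from right angles, a failure means that \<open>\<alpha>\<close> and
  \<open>\<delta>\<close> are equal or supplementary. Orthodiagonality then forces the same on
  \<open>\<beta>\<close> and \<open>\<gamma>\<close>, against nondegeneracy.\<close>

lemma lambda_nonzero_denominators:
  shows "\<alpha> = pi / 2 \<Longrightarrow> \<delta> = pi / 2 \<Longrightarrow> cos \<beta> \<noteq> cos \<gamma> \<and> cos \<beta> \<noteq> - cos \<gamma>"
    and "\<alpha> \<noteq> pi / 2 \<Longrightarrow> \<delta> \<noteq> pi / 2 \<Longrightarrow> tan \<delta> \<noteq> tan \<alpha> \<and> tan \<delta> \<noteq> - tan \<alpha>"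
proof -
  assume "\<alpha> = pi / 2" "\<delta> = pi / 2"
  then show "cos \<beta> \<noteq> cos \<gamma> \<and> cos \<beta> \<noteq> - cos \<gamma>"
    using cos_inj_pi[of \<beta> \<gamma>] cos_eq_uminus_cos_iff angles nondegenerate by auto
next
  assume half: "\<alpha> \<noteq> pi / 2" "\<delta> \<noteq> pi / 2"
  then have cos: "cos \<alpha> \<noteq> 0" using angles by (simp add: cos_eq_0_iff_pi_half)
  have "\<delta> \<noteq> \<alpha>"
  proof
    assume "\<delta> = \<alpha>"
    then have "cos \<gamma> = cos \<beta>" using od cos by simp
    then show False
      using cos_inj_pi[of \<beta> \<gamma>] angles nondegenerate \<open>\<delta> = \<alpha>\<close> by auto
  qed
  moreover have "\<delta> + \<alpha> \<noteq> pi"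
  proof
    assume sum: "\<delta> + \<alpha> = pi"
    then have "cos \<delta> = - cos \<alpha>" using angles by (simp add: cos_eq_uminus_cos_iff)
    then have "cos \<alpha> * cos \<gamma> = cos \<alpha> * (- cos \<beta>)" using od by simp
    then have "cos \<gamma> = - cos \<beta>" using cos by (simp only: mult_cancel_left) simp
    then show False
      using cos_eq_uminus_cos_iff[of \<gamma> \<beta>] angles nondegenerate sum by auto
  qed
  ultimately show "tan \<delta> \<noteq> tan \<alpha> \<and> tan \<delta> \<noteq> - tan \<alpha>"
    using angles half by (simp add: tan_eq_tan_iff tan_eq_uminus_tan_iff)
qed

lemma od_lambda_nonzero: "od_lambda \<alpha> \<beta> \<gamma> \<delta> \<noteq> 0"
  using lambda_nonzero_denominators by (auto simp: od_lambda_def add_eq_0_iff)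

text \<open>The assumption covers the cases in which \<open>\<lambda> - 1\<close> is a factor of
  \<open>\<nu>\<close>.\<close>

lemma od_lambda_neq_1:
  assumes "\<delta> \<noteq> pi / 2 \<or> \<alpha> = pi / 2 \<and> \<gamma> \<noteq> pi / 2"
  shows "od_lambda \<alpha> \<beta> \<gamma> \<delta> \<noteq> 1"
  using assms lambda_nonzero_denominators tan_nonzero[of \<alpha>] cos_eq_0_iff_pi_half[of \<gamma>] angles
  by (auto simp: od_lambda_def divide_eq_1_iff)

end

lemma od_mu_eq_lambda: "od_mu \<alpha> \<beta> \<gamma> \<delta> = od_lambda \<gamma> \<beta> \<alpha> \<delta>"
  by (simp add: od_mu_def od_lambda_def)

lemma od_quadrilateral_swap:
  assumes "od_quadrilateral \<alpha> \<beta> \<gamma> \<delta>"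
  shows "od_quadrilateral \<gamma> \<beta> \<alpha> \<delta>"
  using assms by (simp add: od_quadrilateral_def algebra_simps)

lemma (in od_quadrilateral) od_nu_nonzero: "od_nu \<alpha> \<beta> \<gamma> \<delta> \<noteq> 0"
proof -
  interpret swap: od_quadrilateral \<gamma> \<beta> \<alpha> \<delta>
    by (rule od_quadrilateral_swap) (rule od_quadrilateral_axioms)
  have cos: "cos x \<noteq> 0" if "x \<in> {0<..<pi}" "x \<noteq> pi / 2" for x
    using that by (simp add: cos_eq_0_iff_pi_half)
  consider "\<delta> \<noteq> pi / 2" | "\<delta> = pi / 2" "\<alpha> = pi / 2" "\<gamma> = pi / 2" | "\<delta> = pi / 2" "\<gamma> = pi / 2" "\<alpha> \<noteq> pi / 2"
    | "\<delta> = pi / 2" "\<alpha> = pi / 2" "\<gamma> \<noteq> pi / 2"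
    using od cos[of \<alpha>] cos[of \<gamma>] angles by fastforce
  then show ?thesis
  proof cases
    case 1
    then show ?thesis
      using od_lambda_neq_1 swap.od_lambda_neq_1 cos[of \<delta>] angles by (simp add: od_nu_def od_mu_eq_lambda)
  next
    case 2
    then have "\<beta> \<noteq> pi / 2" using nondegenerate by auto
    then show ?thesis using 2 cos[of \<beta>] angles by (simp add: od_nu_def)
  next
    case 3
    then show ?thesis
      using swap.od_lambda_neq_1 tan_nonzero[of \<alpha>] angles by (simp add: od_nu_def od_mu_eq_lambda)
  next
    case 4
    then show ?thesis
      using od_lambda_neq_1 tan_nonzero[of \<gamma>] angles by (simp add: od_nu_def)
  qed
qed

section \<open>From the mesh to the linearised data\<close>

lemma mesh_od_quadrilateral:
  assumes "skew_Kokotsakis_mesh M" "elliptic_OI M"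
  shows "od_quadrilateral (m_alpha M i) (m_beta M i) (m_gamma M i) (m_delta M i)"
proof
  show "m_alpha M i \<in> {0<..<pi}" "m_beta M i \<in> {0<..<pi}" "m_gamma M i \<in> {0<..<pi}" "m_delta M i \<in> {0<..<pi}"
    using assms(1) by (simp_all add: skew_Kokotsakis_mesh_def)
  show "cos (m_alpha M i) * cos (m_gamma M i) = cos (m_beta M i) * cos (m_delta M i)"
    using assms(2) by (simp add: elliptic_OI_def orthodiagonal_def)
  have "m_alpha M i + s1 * m_beta M i + s2 * m_gamma M i + s3 * m_delta M i \<noteq> 2 * pi * of_int j"
    if "s1 \<in> {-1, 1}" "s2 \<in> {-1, 1}" "s3 \<in> {-1, 1}" for s1 s2 s3 and j :: int
    using assms(2) that unfolding elliptic_OI_def elliptic_def by blast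
  from this[of 1 "-1" "-1" 0] this[of "-1" "-1" 1 0] this[of 1 1 1 1]
  show "m_alpha M i + m_beta M i \<noteq> m_gamma M i + m_delta M i"
    "m_alpha M i + m_delta M i \<noteq> m_beta M i + m_gamma M i"
    "m_alpha M i + m_beta M i + m_gamma M i + m_delta M i \<noteq> 2 * pi"
    by auto
qed

theorem theorem4p5:
  fixes M :: mesh
  assumes "skew_Kokotsakis_mesh M"
    and "elliptic_OI M"
    and "local_existence M"
  shows "flexible M \<longleftrightarrow>
    ((\<forall>i. m_lambda M i < 0 \<and> m_mu M i > 0) \<and>
       (case m_t M 2 of
          None \<Rightarrow> 16 * sqrt (m_mu M 1 * m_mu M 2) - \<bar>m_nu M 1 * m_nu M 2\<bar> < 0
        | Some t \<Rightarrow> t = 0 \<or>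
            16 * sqrt (m_mu M 1 * m_mu M 2) - \<bar>m_nu M 1 * m_nu M 2\<bar>
              < (4 * \<bar>m_nu M 2\<bar> * sqrt (m_mu M 1) + 4 * \<bar>m_nu M 1\<bar> * sqrt (m_mu M 2)) / \<bar>t\<bar>))
    \<or>
    ((\<forall>i. m_lambda M i > 0 \<and> m_mu M i < 0) \<and>
       (case m_t M 3 of
          None \<Rightarrow> 16 * sqrt (m_lambda M 2 * m_lambda M 3) - \<bar>m_nu M 2 * m_nu M 3\<bar> < 0
        | Some t \<Rightarrow> t = 0 \<or>
            16 * sqrt (m_lambda M 2 * m_lambda M 3) - \<bar>m_nu M 2 * m_nu M 3\<bar>
              < (4 * \<bar>m_nu M 3\<bar> * sqrt (m_lambda M 2) + 4 * \<bar>m_nu M 2\<bar> * sqrt (m_lambda M 3)) / \<bar>t\<bar>))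
    \<or>
    (\<not> (\<forall>i. m_lambda M i < 0 \<and> m_mu M i > 0) \<and> \<not> (\<forall>i. m_lambda M i > 0 \<and> m_mu M i < 0))"
proof -
  define k :: "4 \<Rightarrow> real" where
    "k i = (if i = 1 then m_mu M 1 else if i = 2 then m_lambda M 2 else if i = 3 then m_mu M 3 else m_lambda M 4)" for i
  have k: "k 1 = m_mu M 1" "k 2 = m_lambda M 2" "k 3 = m_mu M 3" "k 4 = m_lambda M 4"
    by (simp_all add: k_def)
  have pred: "(2::4) - 1 = 1" "(4::4) - 1 = 3" "(1::4) - 1 = 4" "(3::4) - 1 = 2"
    by simp_all
  have "\<forall>i\<in>{2, 4}. (m_F M i = 0 \<longrightarrow> m_lambda M (i - 1) = m_lambda M i) \<and>
      (m_F M i \<noteq> 0 \<longrightarrow> m_lambda M (i - 1) = -1 \<and> m_lambda M i = -1)"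
    and "\<forall>j\<in>{1, 3}. (m_F M j = 0 \<longrightarrow> m_mu M (j - 1) = m_mu M j) \<and>
      (m_F M j \<noteq> 0 \<longrightarrow> m_mu M (j - 1) = -1 \<and> m_mu M j = -1)"
    using assms(2) unfolding elliptic_OI_def by blast+
  then have lambda: "m_lambda M 1 = m_lambda M 2" "m_lambda M 3 = m_lambda M 4"
    and mu: "m_mu M 4 = m_mu M 1" "m_mu M 2 = m_mu M 3"
    and F: "m_F M 1 \<noteq> 0 \<longrightarrow> m_mu M 1 = -1" "m_F M 2 \<noteq> 0 \<longrightarrow> m_lambda M 2 = -1"
      "m_F M 3 \<noteq> 0 \<longrightarrow> m_mu M 3 = -1" "m_F M 4 \<noteq> 0 \<longrightarrow> m_lambda M 4 = -1"
    unfolding ball_simps pred by metis+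
  note quad = mesh_od_quadrilateral[OF assms(1,2)]
  have nz: "m_lambda M i \<noteq> 0" "m_mu M i \<noteq> 0" "m_nu M i \<noteq> 0" for i
    using od_quadrilateral.od_lambda_nonzero[OF quad] 
      od_quadrilateral.od_lambda_nonzero[OF od_quadrilateral_swap[OF quad]]
      od_quadrilateral.od_nu_nonzero[OF quad]
    by (simp_all add: m_lambda_def m_mu_def m_nu_def od_mu_eq_lambda)
  interpret OI_mesh M "m_nu M" "m_F M" k
  proof
    have "\<forall>i. k i \<noteq> 0" "\<forall>i. m_F M i \<noteq> 0 \<longrightarrow> k i = -1"
      unfolding forall_4 k using nz F by blast+
    then show "k i \<noteq> 0" "m_F M i \<noteq> 0 \<longrightarrow> k i = -1" for i by blast+
    show "minors_vanish (oi_proj_row1 (m_nu M 1) (m_nu M 2) (m_F M 2) (m_F M 3))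
        (oi_proj_row2 (m_nu M 3) (m_nu M 4) (m_F M 1) (m_F M 4))"
      using assms(2) by (simp add: elliptic_OI_def)
  qed (simp_all only: k lambda mu nz not_False_eq_True)
  have local: "m_lambda M i > 0 \<longrightarrow> m_mu M i > 0 \<longrightarrow> 16 * (m_lambda M i * m_mu M i) < (m_nu M i)\<^sup>2" for i
    using assms(3)[unfolded local_existence_def, rule_format, of i] by (auto simp: field_simps)
  have "\<forall>i. k i > 0 \<longrightarrow> k (i + 1) > 0 \<longrightarrow> 16 * k i * k (i + 1) < (m_nu M i)\<^sup>2"
    unfolding forall_4 succ_4 k
    using local[of 1] local[of 2] local[of 3] local[of 4] unfolding lambda mu by (simp add: mult_ac)
  then have flex: "flexible M \<longleftrightarrow>
    (k 1 > 0 \<and> k 2 < 0 \<and> k 3 > 0 \<and> k 4 < 0 \<longrightarrow>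
      arcs_overlap (half_window (m_nu M 1) (k 1)) (half_window (m_nu M 2) (k 3)) (m_F M 2)) \<and>
    (k 1 < 0 \<and> k 2 > 0 \<and> k 3 < 0 \<and> k 4 > 0 \<longrightarrow>
      arcs_overlap (half_window (m_nu M 2) (k 2)) (half_window (m_nu M 3) (k 4)) (m_F M 3))"
    by (intro flexible_iff) blast
  have all1: "(\<forall>i. m_lambda M i < 0 \<and> m_mu M i > 0) \<longleftrightarrow> k 1 > 0 \<and> k 2 < 0 \<and> k 3 > 0 \<and> k 4 < 0"
    unfolding forall_4 k lambda mu by blast
  have all2: "(\<forall>i. m_lambda M i > 0 \<and> m_mu M i < 0) \<longleftrightarrow> k 1 < 0 \<and> k 2 > 0 \<and> k 3 < 0 \<and> k 4 > 0"
    unfolding forall_4 k lambda mu by blast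
  note half = arcs_overlap_iff_half_angle[of _ _ _ _ M]
  \<comment> \<open>The two sign patterns exclude each other and case (3) is the failure of both, so
    the disjunction agrees propositionally with the two implications in \<open>flex\<close>.\<close>
  show ?thesis
    unfolding all1 all2 flex
    unfolding mu(2) lambda(2) k(1-4)[symmetric]
    using half[of "k 1" "k 3" "m_nu M 1" "m_nu M 2" 2] half[of "k 2" "k 4" "m_nu M 2" "m_nu M 3" 3]
    by argo
qed

end
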